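(* Let $f$ be a twist map of the annulus, let $c\in\mathbb{R}$, and let $u_c:\mathbb{R}\to\mathbb{R}$ be a discrete weak K.A.M. solution for $f$ at cohomology class $c$. Let $x_0\in\operatorname{Sing}(u_c)$ and define the one-sided sequence $\{x_n\}_{n\in\mathbb{N}}$ iteratively by $$x_{n+1}:=\mathop{\mathrm{arg\,max}}_{y\in\mathbb{R}}\{u_c(y)-S_c(x_n,y)\}\qquad\text{for any } n\in\mathbb{N}.$$ Then: (a) the whole one-sided sequence satisfies $\{x_n\}_{n\in\mathbb{N}}\subset\operatorname{Sing}(u_c)$; (b) the limit $\rho_c:=\lim_{n\to+\infty}\frac{x_n-x_0}{n}$ exists and is independent of $x_0$; (c) $\rho_c$ equals the rotation number $\alpha'(c)$ of the associated Aubry-Mather set.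
   Context: Let $\mathbb{T}=\mathbb{R}/\mathbb{Z}$. A twist map of the annulus is a $C^1$-diffeomorphism $f:\mathbb{T}\times\mathbb{R}\to\mathbb{T}\times\mathbb{R}$ such that: (1) $f$ is isotopic to the identity; (2) $f$ is exact symplectic, i.e. if $f(\theta,p)=(\theta',p')$ then the $1$-form $p'd\theta'-p\,d\theta$ is exact; (3) if $F:\mathbb{R}^2\to\mathbb{R}^2$, $F(x,p)=(y,p')$, is a lift of $f$, there is $\varepsilon>0$ with $0<\frac{\partial y}{\partial p}(x,p)<\frac1\varepsilon$ for all $(x,p)$. Fix a lift $F$ of $f$. Its generating function is a $C^2$ function $S:\mathbb{R}^2\to\mathbb{R}$ (which exists and is unique up to an additive constant) such that $S(x+1,y+1)=S(x,y)$; there is $\varepsilon>0$ with $\frac{\partial^2S}{\partial x\partial y}<-\varepsilon$ everywhere; and $F(x,p)=(y,p')$ if and only if $p=-\partial_1S(x,y)$ and $p'=\partial_2S(x,y)$. For $c\in\mathbb{R}$ put $S_c(x,y)=S(x,y)+c(x-y)$. For a bounded $1$-periodic function $u:\mathbb{R}\to\mathbb{R}$ put $T^-[u](x)=\inf_{y\in\mathbb{R}}\{u(y)+S_c(y,x)\}$. There is a unique constant $\overline{S}_c\in\mathbb{R}$ for which $u=T^-[u]-\overline{S}_c$ has a continuous $1$-periodic solution $u$; any such solution is called a discrete weak K.A.M. solution for $f$ at cohomology class $c$. Mather's function is $\alpha(c)=-\overline{S}_c$; it is differentiable at every $c\in\mathbb{R}$. $\operatorname{Sing}(u_c)$ is the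 set of points of $\mathbb{R}$ at which $u_c$ is not differentiable. For every $x\in\mathbb{R}$ the set of maximizers of $y\mapsto u_c(y)-S_c(x,y)$ is a singleton, so the sequence $\{x_n\}$ is well defined. Aubry-Mather set at class $c$: a continuous $1$-periodic $u$ is a sub-action for $S_c$ if $u(y)-u(x)\le S_c(x,y)-\overline{S}_c$ for all $x,y$. The projected Aubry set $\mathcal{A}_c$ is the set of $x$ for which there is $y$ with $u(y)-u(x)=S_c(x,y)-\overline{S}_c$ for every sub-action $u$. Every sub-action $u$ is differentiable on $\mathcal{A}_c$ with derivative there independent of $u$; $\mathcal{A}_c^*=\{(x,du(x)):x\in\mathcal{A}_c\}$. The set $(0,c)+\mathcal{A}_c^*$ is $F$-invariant, and its rotation number is $\lim_{n\to\pm\infty}\frac{\pi_1(F^n(x,p))-x}{n}$ for $(x,p)$ in it ($\pi_1$ the first coordinate), which exists, is independent of $(x,p)$, and equals $\alpha'(c)$. *)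

theory Defs
  imports "HOL-Analysis.Analysis"
begin

definition C1 :: "('a::real_normed_vector \<Rightarrow> 'b::real_normed_vector) \<Rightarrow> bool" where
  "C1 g \<longleftrightarrow> (\<exists>g'. (\<forall>z. (g has_derivative blinfun_apply (g' z)) (at z)) \<and> continuous_on UNIV g')"

definition C2 :: "('a::real_normed_vector \<Rightarrow> 'b::real_normed_vector) \<Rightarrow> bool" where
  "C2 g \<longleftrightarrow> (\<exists>g'. (\<forall>z. (g has_derivative blinfun_apply (g' z)) (at z)) \<and> C1 g')"

definition periodic1 :: "(real \<Rightarrow> real) \<Rightarrow> bool" where
  "periodic1 u \<longleftrightarrow> (\<forall>x. u (x + 1) = u x)"

text \<open>The circle R/Z is realised as the unit circle of the complex plane, the class of x being
  cis (2 pi x). The annulus is then an embedded submanifold of C x R, and its universal covering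
  \<open>annulus_proj\<close> is a local diffeomorphism; hence a self-map f of the annulus is of class C1 iff
  \<open>f \<circ> annulus_proj\<close> is of class C1 as a map from the plane to C x R. Values of f off the annulus
  are irrelevant.\<close>

definition annulus :: "(complex \<times> real) set" where
  "annulus = sphere 0 1 \<times> UNIV"

definition annulus_proj :: "real \<times> real \<Rightarrow> complex \<times> real" where
  "annulus_proj = (\<lambda>(x, p). (cis (2 * pi * x), p))"

definition C1_annulus_map :: "(complex \<times> real \<Rightarrow> complex \<times> real) \<Rightarrow> bool" where
  "C1_annulus_map f \<longleftrightarrow> f ` annulus \<subseteq> annulus \<and> C1 (f \<circ> annulus_proj)"

definition C1_annulus_diffeo :: "(complex \<times> real \<Rightarrow> complex \<times> real) \<Rightarrow> bool" where
  "C1_annulus_diffeo f \<longleftrightarrow> C1_annulus_map f \<and>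
     (\<exists>g. C1_annulus_map g \<and> (\<forall>z\<in>annulus. g (f z) = z \<and> f (g z) = z))"

text \<open>Isotopy means homotopy through homeomorphisms; since this is a hypothesis, it is the most
  permissive choice (an isotopy through diffeomorphisms is in particular one of this kind).\<close>

definition isotopic_to_id :: "(complex \<times> real \<Rightarrow> complex \<times> real) \<Rightarrow> bool" where
  "isotopic_to_id f \<longleftrightarrow>
     homotopic_with_canon (\<lambda>h. \<exists>g. homeomorphism annulus annulus h g) annulus annulus id f"

definition is_lift :: "(complex \<times> real \<Rightarrow> complex \<times> real) \<Rightarrow> (real \<times> real \<Rightarrow> real \<times> real) \<Rightarrow> bool" where
  "is_lift f F \<longleftrightarrow> continuous_on UNIV F \<and> annulus_proj \<circ> F = f \<circ> annulus_proj"

text \<open>The 1-form p' d theta' - p d theta is the differential of a function G on the annulus. The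
  equation is written on the universal covering, where d theta pulls back to dx and d theta' to the
  differential of the first component of any lift (two lifts differ by an integer translation).\<close>

definition exact_symplectic :: "(complex \<times> real \<Rightarrow> complex \<times> real) \<Rightarrow> bool" where
  "exact_symplectic f \<longleftrightarrow>
     (\<exists>G :: complex \<times> real \<Rightarrow> real. \<forall>F. is_lift f F \<longrightarrow>
        (\<forall>z. ((G \<circ> annulus_proj) has_derivative
                (\<lambda>h. snd (F z) * fst (frechet_derivative F (at z) h) - snd z * fst h)) (at z)))"

definition twist_map :: "(complex \<times> real \<Rightarrow> complex \<times> real) \<Rightarrow> bool" where
  "twist_map f \<longleftrightarrow>
     C1_annulus_diffeo f \<and> isotopic_to_id f \<and> exact_symplectic f \<and>
     (\<forall>F. is_lift f F \<longrightarrow>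
        (\<exists>\<epsilon>>0. \<forall>x p. 0 < deriv (\<lambda>q. fst (F (x, q))) p \<and> deriv (\<lambda>q. fst (F (x, q))) p < 1 / \<epsilon>))"

definition D1 :: "(real \<times> real \<Rightarrow> real) \<Rightarrow> real \<times> real \<Rightarrow> real" where
  "D1 S = (\<lambda>(x, y). deriv (\<lambda>s. S (s, y)) x)"

definition D2 :: "(real \<times> real \<Rightarrow> real) \<Rightarrow> real \<times> real \<Rightarrow> real" where
  "D2 S = (\<lambda>(x, y). deriv (\<lambda>t. S (x, t)) y)"

definition generating_function :: "(real \<times> real \<Rightarrow> real \<times> real) \<Rightarrow> (real \<times> real \<Rightarrow> real) \<Rightarrow> bool" where
  "generating_function F S \<longleftrightarrow>
     C2 S \<and>
     (\<forall>x y. S (x + 1, y + 1) = S (x, y)) \<and>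
     (\<exists>\<epsilon>>0. \<forall>x y. D1 (D2 S) (x, y) < - \<epsilon>) \<and>
     (\<forall>x p y p'. F (x, p) = (y, p') \<longleftrightarrow> p = - D1 S (x, y) \<and> p' = D2 S (x, y))"

definition Sc :: "(real \<times> real \<Rightarrow> real) \<Rightarrow> real \<Rightarrow> real \<times> real \<Rightarrow> real" where
  "Sc S c = (\<lambda>(x, y). S (x, y) + c * (x - y))"

definition Tminus :: "(real \<times> real \<Rightarrow> real) \<Rightarrow> real \<Rightarrow> (real \<Rightarrow> real) \<Rightarrow> real \<Rightarrow> real" where
  "Tminus S c u x = (INF y. u y + Sc S c (y, x))"

definition Sbar :: "(real \<times> real \<Rightarrow> real) \<Rightarrow> real \<Rightarrow> real" where
  "Sbar S c = (THE s. \<exists>u. continuous_on UNIV u \<and> periodic1 u \<and> (\<forall>x. u x = Tminus S c u x - s))"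

definition weak_KAM_solution :: "(real \<times> real \<Rightarrow> real) \<Rightarrow> real \<Rightarrow> (real \<Rightarrow> real) \<Rightarrow> bool" where
  "weak_KAM_solution S c u \<longleftrightarrow>
     continuous_on UNIV u \<and> periodic1 u \<and> (\<forall>x. u x = Tminus S c u x - Sbar S c)"

definition Mather_alpha :: "(real \<times> real \<Rightarrow> real) \<Rightarrow> real \<Rightarrow> real" where
  "Mather_alpha S c = - Sbar S c"

definition Sing :: "(real \<Rightarrow> real) \<Rightarrow> real set" where
  "Sing u = {x. \<not> u differentiable (at x)}"

definition forward_step :: "(real \<times> real \<Rightarrow> real) \<Rightarrow> real \<Rightarrow> (real \<Rightarrow> real) \<Rightarrow> real \<Rightarrow> real" where
  "forward_step S c u x = arg_max (\<lambda>y. u y - Sc S c (x, y)) (\<lambda>_. True)"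

definition sub_action :: "(real \<times> real \<Rightarrow> real) \<Rightarrow> real \<Rightarrow> (real \<Rightarrow> real) \<Rightarrow> bool" where
  "sub_action S c u \<longleftrightarrow>
     continuous_on UNIV u \<and> periodic1 u \<and> (\<forall>x y. u y - u x \<le> Sc S c (x, y) - Sbar S c)"

definition projected_Aubry :: "(real \<times> real \<Rightarrow> real) \<Rightarrow> real \<Rightarrow> real set" where
  "projected_Aubry S c =
     {x. \<exists>y. \<forall>u. sub_action S c u \<longrightarrow> u y - u x = Sc S c (x, y) - Sbar S c}"

text \<open>The derivative of a sub-action at a point of the projected Aubry set exists and does not depend
  on the sub-action, so p is pinned down as the common derivative of all of them.\<close>

definition Aubry_star :: "(real \<times> real \<Rightarrow> real) \<Rightarrow> real \<Rightarrow> (real \<times> real) set" where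
  "Aubry_star S c =
     {(x, p). x \<in> projected_Aubry S c \<and> (\<forall>u. sub_action S c u \<longrightarrow> (u has_real_derivative p) (at x))}"

definition Aubry_Mather_set :: "(real \<times> real \<Rightarrow> real) \<Rightarrow> real \<Rightarrow> (real \<times> real) set" where
  "Aubry_Mather_set S c = (\<lambda>z. (0, c) + z) ` Aubry_star S c"

text \<open>Nonemptiness of M makes the rotation number unique when it exists. The second limit is the one
  for n tending to minus infinity, with n replaced by -n.\<close>

definition has_rotation_number ::
  "(real \<times> real \<Rightarrow> real \<times> real) \<Rightarrow> (real \<times> real) set \<Rightarrow> real \<Rightarrow> bool" where
  "has_rotation_number F M \<rho> \<longleftrightarrow>
     M \<noteq> {} \<and>
     (\<forall>(x, p)\<in>M.
        (\<lambda>n. (fst ((F ^^ n) (x, p)) - x) / real n) \<longlonglongrightarrow> \<rho> \<and>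
        (\<lambda>n. (fst ((inv F ^^ n) (x, p)) - x) / (- real n)) \<longlonglongrightarrow> \<rho>)"

end

theory Submission
  imports Defs "HOL-Complex_Analysis.Great_Picard"
begin

text \<open>
  Write \<open>s\<close> for the critical value and call \<open>S_c(x,y) - s - (u(y) - u(x))\<close> the deficit of the step
  from \<open>x\<close> to \<open>y\<close>. It is nonnegative for every sub-action \<open>u\<close>, and a step is calibrated when its deficit
  vanishes. The twist condition says that uncrossing two crossing steps lowers the action
  (\<open>crossing\<close>), and that a derivative of \<open>S\<close> at one end point of a step determines the other end point.

  Singularities propagate (\<open>forward_max_singular\<close>) because a derivative of \<open>u\<close> at the maximiser \<open>x_1\<close> would
  make the step from \<open>x_0\<close> to \<open>x_1\<close> calibrated, and the calibrated steps into and out of \<open>x_0\<close> would bound \<open>u\<close> at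
  \<open>x_0\<close> from both sides by smooth functions.

  A tight step is one that is calibrated for all sub-actions simultaneously. Such steps exist, as limits of steps
  of backward calibrated orbits (\<open>tight_exists\<close>), and they extend to the past and to the future
  (\<open>tight_predecessor\<close>, \<open>tight_successor\<close>); the Aubry-Mather set consists of them, and \<open>F\<close> moves
  along them. Sub-actions are differentiable on tight orbits, so a singular orbit never meets one, and
  by monotonicity of maximisers it stays between two consecutive integer translates of a tight orbit. The same holds for calibrated
  chains. Therefore the displacement over \<open>n\<close> steps of all these chains is \<open>n \<rho>\<close> up to the error 2, with one number
  \<open>\<rho>\<close> (\<open>rotation_number_exists\<close>). This gives the two limits of displacements.

  It remains to see that \<open>\<rho>\<close> is the derivative of \<open>\<alpha>\<close> at \<open>c\<close>. The inequality
  \<open>\<alpha>(c + e) \<ge> \<alpha>(c) + e \<rho>\<close> follows by testing the class \<open>c + e\<close> with a tight orbit of class \<open>c\<close>. For the opposite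
  one, a compactness argument shows that a chain whose average displacement differs from \<open>\<rho>\<close> by more than a
  small amount has a total deficit proportional to the excess (\<open>blocks_displacement\<close>). A
  calibrated chain of class \<open>c + e\<close> has, on average over a long time, a deficit per step at class \<open>c\<close> of at most \<open>|e|\<close> times its
  deviation per step from \<open>\<rho>\<close>. For small \<open>e\<close> the two estimates force the deviation, and then
  \<open>(\<alpha>(c + e) - \<alpha>(c) - e \<rho>) / |e|\<close>, to be small. The existence of weak K.A.M. solutions at every class
  (\<open>weak_kam_exists\<close>) is what gives \<open>\<alpha>\<close> its meaning near \<open>c\<close>.
\<close>

section \<open>Real-variable preliminaries\<close>

lemma periodic_shift_int:
  fixes f :: "real \<Rightarrow> 'a"
  assumes "\<And>x. f (x + 1) = f x"
  shows "f (x + of_int k) = f x"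
proof (induction k rule: int_induct[where k = 0])
  case base
  show ?case by simp
next
  case (step1 i)
  have "f (x + of_int (i + 1)) = f ((x + of_int i) + 1)" by (simp add: algebra_simps)
  then show ?case using assms step1 by simp
next
  case (step2 i)
  have "f (x + of_int (i - 1)) = f ((x + of_int (i - 1)) + 1)" using assms by metis
  also have "(x + of_int (i - 1)) + 1 = x + of_int i" by simp
  finally show ?case using step2 by simp
qed

text \<open>Comparing b(m n) with m b(n) and with n b(m) shows that every (b(m) - C) / m lies below every
  (b(n) + C) / n; any number separating the two families is the slope. The error stays bounded by
  the same C for all n, which a mere limit of b(n) / n would not give.\<close>

lemma quasi_additive_linear:
  fixes b :: "nat \<Rightarrow> real"
  assumes qa: "\<And>m n. \<bar>b (m + n) - b m - b n\<bar> \<le> C"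
  shows "\<exists>s. \<forall>n. \<bar>b n - real n * s\<bar> \<le> C"
proof -
  have mult: "\<bar>b (Suc m * n) - real (Suc m) * b n\<bar> \<le> real m * C" for m n
  proof (induction m)
    case 0
    show ?case by simp
  next
    case (Suc m)
    have "b (Suc (Suc m) * n) - real (Suc (Suc m)) * b n
        = (b (n + Suc m * n) - b n - b (Suc m * n)) + (b (Suc m * n) - real (Suc m) * b n)"
      by (simp add: algebra_simps)
    moreover have "real (Suc m) * C = C + real m * C" by (simp add: algebra_simps)
    ultimately show ?case using Suc.IH qa[of n "Suc m * n"] by linarith
  qed
  \<comment> \<open>The slope is the supremum of the lower family.\<close>
  define D where "D = {(b m - C) / real m |m. m > 0}"
  have le: "(b m - C) / real m \<le> (b n + C) / real n" if pos: "m > 0" "n > 0" for m n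
  proof -
    obtain m' n' where mn: "m = Suc m'" "n = Suc n'" using pos by (auto simp: gr0_conv_Suc)
    have "\<bar>b (m * n) - real m * b n\<bar> \<le> real m' * C"
      using mult[of m' n] mn by simp
    moreover have "\<bar>b (m * n) - real n * b m\<bar> \<le> real n' * C"
      using mult[of n' m] mn by (simp add: mult.commute)
    moreover have "C \<ge> 0" using qa[of 0 0] by linarith
    moreover have "real m * C = C + real m' * C" "real n * C = C + real n' * C"
      using mn by (simp_all add: algebra_simps)
    ultimately have "real n * b m - real m * b n \<le> real m * C + real n * C"
      by (simp only: abs_le_iff) (smt (verit))
    then show ?thesis using pos by (simp add: field_simps)
  qed
  have bdd: "bdd_above D"
    using le[of _ 1] by (auto simp: D_def bdd_above_def)
  have ne: "D \<noteq> {}" by (auto simp: D_def)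
  have "\<bar>b n - real n * Sup D\<bar> \<le> C" for n
  proof (cases "n = 0")
    case True
    have "\<bar>b 0\<bar> \<le> C" using qa[of 0 0] by simp
    then show ?thesis using True by simp
  next
    case False
    then have n: "n > 0" by simp
    have "(b n - C) / real n \<le> Sup D"
      using n by (intro cSup_upper bdd) (auto simp: D_def)
    moreover have "Sup D \<le> (b n + C) / real n"
      using ne le n by (intro cSup_least) (auto simp: D_def)
    ultimately show ?thesis using n by (simp add: field_simps abs_le_iff)
  qed
  then show ?thesis by blast
qed

lemma locally_lipschitz_continuous:
  fixes v :: "real \<Rightarrow> real"
  assumes "\<And>x x'. \<bar>x' - x\<bar> \<le> 1 \<Longrightarrow> \<bar>v x' - v x\<bar> \<le> L * \<bar>x' - x\<bar>"
  shows "continuous_on UNIV v"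
proof -
  have "(v \<longlongrightarrow> v x) (at x)" for x
  proof (rule LIM_zero_cancel, rule Lim_null_comparison)
    show "\<forall>\<^sub>F y in at x. norm (v y - v x) \<le> L * \<bar>y - x\<bar>"
      unfolding eventually_at using assms by (intro exI[of _ 1]) (auto simp: dist_real_def)
    show "((\<lambda>y. L * \<bar>y - x\<bar>) \<longlongrightarrow> 0) (at x)"
      by (auto intro!: tendsto_eq_intros)
  qed
  then show ?thesis by (simp add: continuous_on_def)
qed

lemma sum_lessThan_add:
  "(\<Sum>i<m + n. f i) = (\<Sum>i<m. f i) + (\<Sum>i<n. f (m + i :: nat))" for f :: "nat \<Rightarrow> real"
  by (induction n) auto

lemma nonneg_of_multiples_bounded_below:
  fixes A D :: real
  assumes "\<And>n::nat. - D \<le> real n * A"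
  shows "0 \<le> A"
proof (rule ccontr)
  assume "\<not> 0 \<le> A"
  then obtain n where "D < real n * (- A)" using ex_less_of_nat_mult[of "- A" D] by auto
  then show False using assms[of n] by simp
qed

lemma average_displacement_tendsto:
  fixes d :: "nat \<Rightarrow> real"
  assumes "\<And>n. \<bar>d n - real n * \<rho>\<bar> \<le> B"
  shows "(\<lambda>n. d n / real n) \<longlonglongrightarrow> \<rho>"
proof (rule LIM_zero_cancel, rule Lim_null_comparison)
  show "\<forall>\<^sub>F n in sequentially. norm (d n / real n - \<rho>) \<le> B * (1 / real n)"
    unfolding eventually_sequentially
  proof (intro exI allI impI)
    fix n :: nat assume n: "1 \<le> n"
    then have "d n / real n - \<rho> = (d n - real n * \<rho>) / real n" by (simp add: field_simps)
    then show "norm (d n / real n - \<rho>) \<le> B * (1 / real n)"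
      using divide_right_mono[OF assms[of n], of "real n"] by simp
  qed
  show "(\<lambda>n. B * (1 / real n)) \<longlonglongrightarrow> 0"
    using tendsto_mult_right_zero[OF lim_1_over_n] by simp
qed

text \<open>A function caught between two differentiable functions that touch at a point is differentiable
  there. It is applied to u at a point with calibrated steps on both sides: the step into the point
  provides the upper function, the step out of it the lower one.\<close>

lemma has_derivative_squeeze:
  fixes f g k :: "real \<Rightarrow> real"
  assumes g: "(g has_real_derivative a) (at x)" and k: "(k has_real_derivative b) (at x)"
    and fg: "\<And>z. f z \<le> g z" and kf: "\<And>z. k z \<le> f z"
    and eq: "g x = f x" "k x = f x"
  shows "a = b" "(f has_real_derivative a) (at x)"
proof -
  have d: "((\<lambda>z. g z - k z) has_real_derivative (a - b)) (at x)"
    by (intro derivative_intros g k)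
  have "a - b = 0"
  proof (rule DERIV_local_min[OF d, of 1])
    show "\<forall>y. \<bar>x - y\<bar> < 1 \<longrightarrow> g x - k x \<le> g y - k y"
      using fg kf eq by (metis diff_ge_0_iff_ge diff_self order_trans)
  qed simp
  then show ab: "a = b" by simp
  have gl: "((\<lambda>z. (g z - g x) / (z - x)) \<longlongrightarrow> a) (at x)"
    using g by (simp add: has_field_derivative_iff)
  have kl: "((\<lambda>z. (k z - k x) / (z - x)) \<longlongrightarrow> a) (at x)"
    using k ab by (simp add: has_field_derivative_iff)
  have "((\<lambda>z. (f z - f x) / (z - x)) \<longlongrightarrow> a) (at x)"
  proof (rule tendsto_sandwich)
    show "\<forall>\<^sub>F z in at x. min ((g z - g x) / (z - x)) ((k z - k x) / (z - x)) \<le> (f z - f x) / (z - x)"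
    proof (rule always_eventually, rule allI)
      fix z
      show "min ((g z - g x) / (z - x)) ((k z - k x) / (z - x)) \<le> (f z - f x) / (z - x)"
        using fg[of z] kf[of z] eq
        by (cases z x rule: linorder_cases) (auto simp: min_le_iff_disj divide_right_mono divide_right_mono_neg)
    qed
    show "\<forall>\<^sub>F z in at x. (f z - f x) / (z - x) \<le> max ((g z - g x) / (z - x)) ((k z - k x) / (z - x))"
    proof (rule always_eventually, rule allI)
      fix z
      show "(f z - f x) / (z - x) \<le> max ((g z - g x) / (z - x)) ((k z - k x) / (z - x))"
        using fg[of z] kf[of z] eq
        by (cases z x rule: linorder_cases) (auto simp: le_max_iff_disj divide_right_mono divide_right_mono_neg)
    qed
    show "((\<lambda>z. min ((g z - g x) / (z - x)) ((k z - k x) / (z - x))) \<longlongrightarrow> a) (at x)"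
      using tendsto_min[OF gl kl] by simp
    show "((\<lambda>z. max ((g z - g x) / (z - x)) ((k z - k x) / (z - x))) \<longlongrightarrow> a) (at x)"
      using tendsto_max[OF gl kl] by simp
  qed
  then show "(f has_real_derivative a) (at x)" by (simp add: has_field_derivative_iff)
qed

lemma touching_derivative_eq:
  fixes f g :: "real \<Rightarrow> real"
  assumes f: "(f has_real_derivative a) (at x)" and g: "(g has_real_derivative b) (at x)"
    and fg: "\<And>z. f z \<le> g z" and eq: "f x = g x"
  shows "a = b"
proof -
  have d: "((\<lambda>z. g z - f z) has_real_derivative (b - a)) (at x)"
    by (intro derivative_intros g f)
  have "b - a = 0"
    by (rule DERIV_local_min[OF d, of 1]) (use fg eq in auto)
  then show ?thesis by simp
qed

lemma coercive_attains_inf: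
  fixes f :: "real \<Rightarrow> real"
  assumes "continuous_on UNIV f" and co: "\<And>y. f y \<ge> \<bar>y - x\<bar> - K"
  shows "\<exists>y. \<forall>z. f y \<le> f z"
proof -
  define R where "R = max 0 (f x + K)"
  have "\<exists>y\<in>{x - R..x + R}. \<forall>z\<in>{x - R..x + R}. f y \<le> f z"
    using assms(1) by (intro continuous_attains_inf) (auto simp: R_def intro: continuous_on_subset)
  then obtain y where y: "\<And>z. z \<in> {x - R..x + R} \<Longrightarrow> f y \<le> f z" by blast
  have "f y \<le> f z" for z
  proof (cases "z \<in> {x - R..x + R}")
    case False
    then have "\<bar>z - x\<bar> > R" by auto
    then have "f x \<le> f z" using co[of z] by (simp add: R_def)
    then show ?thesis using y[of x] by (simp add: R_def)
  qed (use y in auto)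
  then show ?thesis by blast
qed

text \<open>A strip around the diagonal is compact modulo the diagonal integer translations.\<close>

lemma diagonal_periodic_bounded:
  fixes G :: "real \<Rightarrow> real \<Rightarrow> real"
  assumes cont: "continuous_on UNIV (\<lambda>z. G (fst z) (snd z))"
    and per: "\<And>x y. G (x + 1) (y + 1) = G x y"
  shows "\<exists>B. \<forall>x y. \<bar>y - x\<bar> \<le> R \<longrightarrow> \<bar>G x y\<bar> \<le> B"
proof -
  have "compact ((\<lambda>z. G (fst z) (snd z)) ` ({0..1} \<times> {-R..1 + R}))"
    by (intro compact_continuous_image continuous_on_subset[OF cont] compact_Times) auto
  then obtain B where B: "\<And>z. z \<in> {0..1} \<times> {-R..1 + R} \<Longrightarrow> \<bar>G (fst z) (snd z)\<bar> \<le> B"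
    by (force simp: bounded_iff dest!: compact_imp_bounded)
  have "\<bar>G x y\<bar> \<le> B" if "\<bar>y - x\<bar> \<le> R" for x y
  proof -
    have per': "G (x + (t + 1)) (y + (t + 1)) = G (x + t) (y + t)" for t
      using per[of "x + t" "y + t"] by (simp add: add.assoc)
    have "G x y = G (x + of_int (- \<lfloor>x\<rfloor>)) (y + of_int (- \<lfloor>x\<rfloor>))"
      using periodic_shift_int[of "\<lambda>t. G (x + t) (y + t)" 0 "- \<lfloor>x\<rfloor>"] per' by simp
    moreover have "x - \<lfloor>x\<rfloor> \<in> {0..1}" using of_int_floor_le[of x] by (simp add: algebra_simps; linarith)
    moreover have "y - \<lfloor>x\<rfloor> \<in> {-R..1 + R}"
      using that \<open>x - \<lfloor>x\<rfloor> \<in> {0..1}\<close> by (simp add: abs_le_iff) linarith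
    ultimately show ?thesis using B[of "(x - \<lfloor>x\<rfloor>, y - \<lfloor>x\<rfloor>)"] by simp
  qed
  then show ?thesis by blast
qed

lemma periodic_continuous_bounded:
  assumes "continuous_on UNIV u" "periodic1 u"
  shows "\<exists>B. \<forall>x. \<bar>u x\<bar> \<le> (B::real)"
  using diagonal_periodic_bounded[of "\<lambda>x y. u x" 0] assms
  by (force simp: periodic1_def intro: continuous_on_compose2[OF assms(1)] continuous_on_fst)

section \<open>Twist kernels\<close>

text \<open>The kernel h stands for the function S_c, with h1 and h2 its partial derivatives. The last axiom
  is the twist condition in the integrated form in which it is used. All the axioms survive two
  operations: exchanging the two variables, which exchanges past and future, and adding a multiple of
  x - y, which changes the cohomology class.\<close>

locale twist_kernel =
  fixes h h1 h2 :: "real \<Rightarrow> real \<Rightarrow> real" and \<epsilon> :: real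
  assumes eps_pos: "\<epsilon> > 0"
    and shift: "h (x + 1) (y + 1) = h x y"
    and cont: "continuous_on UNIV (\<lambda>z. h (fst z) (snd z))"
    and deriv1: "((\<lambda>s. h s y) has_real_derivative h1 x y) (at x)"
    and deriv2: "((\<lambda>t. h x t) has_real_derivative h2 x y) (at y)"
    and cont1: "continuous_on UNIV (\<lambda>z. h1 (fst z) (snd z))"
    and cont2: "continuous_on UNIV (\<lambda>z. h2 (fst z) (snd z))"
    and twist: "x \<le> x' \<Longrightarrow> h2 x' y \<le> h2 x y - \<epsilon> * (x' - x)"
begin

lemma shift_int: "h (x + of_int k) (y + of_int k) = h x y"
proof -
  have "h (x + (t + 1)) (y + (t + 1)) = h (x + t) (y + t)" for t
    using shift[of "x + t" "y + t"] by (simp add: add.assoc)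
  then show ?thesis using periodic_shift_int[of "\<lambda>t. h (x + t) (y + t)" 0 k] by simp
qed

lemma h2_shift: "h2 (x + 1) (y + 1) = h2 x y"
proof (rule DERIV_unique)
  show "((\<lambda>t. h (x + 1) (t + 1)) has_real_derivative h2 (x + 1) (y + 1)) (at y)"
    using deriv2[of "x + 1" "y + 1"] by (simp only: DERIV_shift)
  show "((\<lambda>t. h (x + 1) (t + 1)) has_real_derivative h2 x y) (at y)"
    using deriv2 by (simp add: shift)
qed

lemma cont_fst: "continuous_on A (\<lambda>s. h s y)"
  using deriv1 by (intro continuous_at_imp_continuous_on ballI) (rule DERIV_isCont)

text \<open>Integral of the twist condition over a rectangle: two crossing segments cost definitely more
  than the two uncrossed ones with the same end points.\<close>

lemma crossing:
  assumes "x \<le> x'" "y \<le> y'"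
  shows "h x y + h x' y' + \<epsilon> * (x' - x) * (y' - y) \<le> h x y' + h x' y"
proof -
  define \<phi> where "\<phi> t = h x t - h x' t - \<epsilon> * (x' - x) * t" for t
  have "\<phi> y \<le> \<phi> y'"
  proof (rule DERIV_nonneg_imp_nondecreasing[OF assms(2)], intro exI conjI)
    fix t
    show "(\<phi> has_real_derivative (h2 x t - h2 x' t - \<epsilon> * (x' - x))) (at t)"
      unfolding \<phi>_def by (auto intro!: derivative_eq_intros deriv2)
    show "0 \<le> h2 x t - h2 x' t - \<epsilon> * (x' - x)"
      using twist[OF assms(1), of t] by simp
  qed
  then show ?thesis by (simp add: \<phi>_def algebra_simps)
qed

lemma crossing_strict:
  assumes "x < x'" "y < y'"
  shows "h x y + h x' y' < h x y' + h x' y"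
  using crossing[of x x' y y'] 
    mult_pos_pos[OF mult_pos_pos[OF eps_pos, of "x' - x"], of "y' - y"] assms by simp

text \<open>The twist condition for the other partial derivative. Only one mixed second derivative is
  controlled, but the crossing inequality is symmetric in the two variables, so differentiating it in
  the first one gives the claim without exchanging derivatives.\<close>

lemma twist1:
  assumes "y \<le> y'"
  shows "h1 x y' \<le> h1 x y - \<epsilon> * (y' - y)"
proof -
  define \<phi> where "\<phi> s = h s y - h s y'  - \<epsilon> * (y' - y) * s" for s
  have d: "(\<phi> has_real_derivative (h1 x y - h1 x y' - \<epsilon> * (y' - y))) (at x)"
    unfolding \<phi>_def by (auto intro!: derivative_eq_intros deriv1)
  have "mono \<phi>"
  proof (rule monoI)
    fix a b :: real assume "a \<le> b"
    then show "\<phi> a \<le> \<phi> b"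
      using crossing[of a b y y'] assms by (simp add: \<phi>_def algebra_simps)
  qed
  then have "0 \<le> h1 x y - h1 x y' - \<epsilon> * (y' - y)"
    using mono_on_imp_deriv_nonneg[of UNIV \<phi>, OF _ d] by (simp add: mono_on_def mono_def)
  then show ?thesis by simp
qed

lemma h2_inj: "h2 x y = h2 x' y \<Longrightarrow> x = x'"
  using twist[of x x' y] twist[of x' x y] eps_pos
  by (smt (verit) mult_pos_pos)

lemma h1_inj: "h1 x y = h1 x y' \<Longrightarrow> y = y'"
  using twist1[of y y' x] twist1[of y' y x] eps_pos
  by (smt (verit) mult_pos_pos)

lemma transposed: "twist_kernel (\<lambda>x y. h y x) (\<lambda>x y. h2 y x) (\<lambda>x y. h1 y x) \<epsilon>"
proof
  show "continuous_on UNIV (\<lambda>z. h (snd z) (fst z))"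
    by (rule continuous_on_compose2[OF cont, where f = "\<lambda>z. (snd z, fst z)", simplified])
      (intro continuous_intros)
  show "continuous_on UNIV (\<lambda>z. h2 (snd z) (fst z))"
    by (rule continuous_on_compose2[OF cont2, where f = "\<lambda>z. (snd z, fst z)", simplified])
      (intro continuous_intros)
  show "continuous_on UNIV (\<lambda>z. h1 (snd z) (fst z))"
    by (rule continuous_on_compose2[OF cont1, where f = "\<lambda>z. (snd z, fst z)", simplified])
      (intro continuous_intros)
qed (use eps_pos shift deriv1 deriv2 twist1 in auto)

lemma tilted:
  "twist_kernel (\<lambda>x y. h x y + e * (x - y)) (\<lambda>x y. h1 x y + e) (\<lambda>x y. h2 x y - e) \<epsilon>"
proof
  show "continuous_on UNIV (\<lambda>z. h (fst z) (snd z) + e * (fst z - snd z))"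
    by (intro continuous_intros cont)
  show "continuous_on UNIV (\<lambda>z. h1 (fst z) (snd z) + e)"
    by (intro continuous_intros cont1)
  show "continuous_on UNIV (\<lambda>z. h2 (fst z) (snd z) - e)"
    by (intro continuous_intros cont2)
  fix x y x' :: real
  show "((\<lambda>s. h s y + e * (s - y)) has_real_derivative h1 x y + e) (at x)"
    by (auto intro!: derivative_eq_intros deriv1)
  show "((\<lambda>t. h x t + e * (x - t)) has_real_derivative h2 x y - e) (at y)"
    by (auto intro!: derivative_eq_intros deriv2)
  show "h2 x' y - e \<le> h2 x y - e - \<epsilon> * (x' - x)" if "x \<le> x'"
    using twist[OF that, of y] by simp
qed (use eps_pos shift in auto)

text \<open>On the diagonal h2 is bounded by periodicity; away from it the twist condition makes it grow
  linearly, so h grows quadratically in y - x and in particular dominates the distance.\<close>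

lemma coercive: "\<exists>K. \<forall>x y. \<bar>y - x\<bar> - K \<le> h x y"
proof -
  obtain M where M: "\<And>x. \<bar>h2 x x\<bar> \<le> M"
    using diagonal_periodic_bounded[OF cont2 h2_shift, of 0] by auto
  obtain B where B: "\<And>x. \<bar>h x x\<bar> \<le> B"
    using diagonal_periodic_bounded[OF cont shift, of 0] by auto
  have quadratic: "h x y \<ge> - B - M * \<bar>y - x\<bar> + \<epsilon> / 2 * (y - x)\<^sup>2" for x y
  proof (cases "x \<le> y")
    case True
    \<comment> \<open>The derivative of this function is nonnegative by the twist condition compared with the diagonal.\<close>
    define \<phi> where "\<phi> t = h x t + M * (t - x) - \<epsilon> / 2 * (t - x)\<^sup>2" for t
    have "\<phi> x \<le> \<phi> y"
    proof (rule DERIV_nonneg_imp_nondecreasing[OF True], intro exI conjI)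
      fix t assume t: "x \<le> t" "t \<le> y"
      show "(\<phi> has_real_derivative (h2 x t + M - \<epsilon> * (t - x))) (at t)"
        unfolding \<phi>_def by (auto intro!: derivative_eq_intros deriv2 simp: field_simps)
      show "0 \<le> h2 x t + M - \<epsilon> * (t - x)"
        using twist[of x t t] t M[of t] by simp
    qed
    then show ?thesis using B[of x] True by (simp add: \<phi>_def abs_le_iff)
  next
    case False
    then have yx: "y \<le> x" by simp
    define \<phi> where "\<phi> t = - h x t + M * (t - x) + \<epsilon> / 2 * (t - x)\<^sup>2" for t
    have "\<phi> y \<le> \<phi> x"
    proof (rule DERIV_nonneg_imp_nondecreasing[OF yx], intro exI conjI)
      fix t assume t: "y \<le> t" "t \<le> x"
      show "(\<phi> has_real_derivative (- h2 x t + M + \<epsilon> * (t - x))) (at t)"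
        unfolding \<phi>_def by (auto intro!: derivative_eq_intros deriv2 simp: field_simps)
      have "\<epsilon> * (t - x) = - (\<epsilon> * (x - t))" by (simp add: algebra_simps)
      then show "0 \<le> - h2 x t + M + \<epsilon> * (t - x)"
        using twist[of t x t] t M[of t] by (simp add: abs_le_iff)
    qed
    moreover have "M * (y - x) = - (M * \<bar>y - x\<bar>)" using yx by (simp add: algebra_simps)
    ultimately show ?thesis using B[of x] by (simp add: \<phi>_def abs_le_iff)
  qed
  have "\<bar>y - x\<bar> - (B + (M + 1)\<^sup>2 / (2 * \<epsilon>)) \<le> h x y" for x y
  proof -
    define t where "t = \<bar>y - x\<bar>"
    \<comment> \<open>Completing the square in the quadratic lower bound minus t.\<close>
    have "0 \<le> (\<epsilon> * t - (M + 1))\<^sup>2 / (2 * \<epsilon>)" using eps_pos by simp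
    also have "\<dots> = \<epsilon> / 2 * t\<^sup>2 - (M + 1) * t + (M + 1)\<^sup>2 / (2 * \<epsilon>)"
      using eps_pos by (simp add: field_simps power2_eq_square)
    finally have "0 \<le> \<epsilon> / 2 * t\<^sup>2 - M * t - t + (M + 1)\<^sup>2 / (2 * \<epsilon>)"
      by (simp add: algebra_simps)
    moreover have "h x y \<ge> - B - M * t + \<epsilon> / 2 * t\<^sup>2"
      using quadratic[of y x] by (simp add: t_def)
    ultimately show ?thesis unfolding t_def[symmetric] by linarith
  qed
  then show ?thesis by blast
qed

lemma min_attained:
  assumes "continuous_on UNIV v" "\<And>x. \<bar>v x\<bar> \<le> B"
  shows "\<exists>y. \<forall>z. v y + h y x \<le> v z + h z x"
proof -
  obtain K where K: "\<And>x y. \<bar>y - x\<bar> - K \<le> h x y" using coercive by blast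
  show ?thesis
  proof (rule coercive_attains_inf)
    show "continuous_on UNIV (\<lambda>y. v y + h y x)" by (intro continuous_intros assms cont_fst)
    show "\<bar>y - x\<bar> - (K + B) \<le> v y + h y x" for y
      using K[of x y] assms(2)[of y] by (simp add: abs_le_iff abs_minus_commute)
  qed
qed

lemma max_attained:
  assumes "continuous_on UNIV v" "\<And>x. \<bar>v x\<bar> \<le> B"
  shows "\<exists>y. \<forall>z. v z - h x z \<le> v y - h x y"
proof -
  interpret tr: twist_kernel "\<lambda>x y. h y x" "\<lambda>x y. h2 y x" "\<lambda>x y. h1 y x" \<epsilon>
    by (rule transposed)
  have "\<exists>y. \<forall>z. - v y + h x y \<le> - v z + h x z"
    using assms by (intro tr.min_attained) (auto intro: continuous_intros)
  then show ?thesis by (smt (verit))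
qed

end

section \<open>The Lax-Oleinik operator and weak K.A.M. solutions\<close>

definition bounded_periodic :: "(real \<Rightarrow> real) \<Rightarrow> bool" where
  "bounded_periodic v \<longleftrightarrow> periodic1 v \<and> (\<exists>B. \<forall>x. \<bar>v x\<bar> \<le> B)"

lemma bounded_periodic_int: "bounded_periodic v \<Longrightarrow> v (x + of_int k) = v x"
  unfolding bounded_periodic_def periodic1_def by (blast intro: periodic_shift_int)

lemma near_shift: "\<exists>k::int. \<bar>y + of_int k - x\<bar> \<le> (1::real)"
proof
  show "\<bar>y + of_int \<lfloor>x - y\<rfloor> - x\<bar> \<le> 1" by linarith
qed

context twist_kernel
begin

definition lax_oleinik :: "(real \<Rightarrow> real) \<Rightarrow> real \<Rightarrow> real" where
  "lax_oleinik v x = (INF y. v y + h y x)"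

lemma lax_oleinik_upper:
  assumes "bounded_periodic v"
  shows "lax_oleinik v x \<le> v y + h y x"
proof -
  obtain K where K: "\<And>x y. \<bar>y - x\<bar> - K \<le> h x y" using coercive by blast
  obtain B where B: "\<And>x. \<bar>v x\<bar> \<le> B" using assms by (auto simp: bounded_periodic_def)
  have "- B - K \<le> v y + h y x" for y
    using K[of x y] B[of y] by linarith
  then have "bdd_below (range (\<lambda>y. v y + h y x))" by (auto simp: bdd_below_def)
  then show ?thesis unfolding lax_oleinik_def by (intro cINF_lower) auto
qed

lemma lax_oleinik_greatest: "(\<And>y. m \<le> v y + h y x) \<Longrightarrow> m \<le> lax_oleinik v x"
  unfolding lax_oleinik_def by (intro cINF_greatest) auto

lemma lax_oleinik_mono:
  assumes "bounded_periodic v" "\<And>x. v x \<le> w x + k"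
  shows "lax_oleinik v x \<le> lax_oleinik w x + k"
proof -
  have "lax_oleinik v x - k \<le> lax_oleinik w x"
  proof (rule lax_oleinik_greatest)
    show "lax_oleinik v x - k \<le> w y + h y x" for y
      using lax_oleinik_upper[OF assms(1), of x y] assms(2)[of y] by simp
  qed
  then show ?thesis by simp
qed

lemma lax_oleinik_periodic:
  assumes "bounded_periodic v"
  shows "lax_oleinik v (x + 1) = lax_oleinik v x"
proof -
  have v: "v (y + 1) = v y" for y using assms by (simp add: bounded_periodic_def periodic1_def)
  have "lax_oleinik v (x + 1) \<le> lax_oleinik v x"
  proof (rule lax_oleinik_greatest)
    show "lax_oleinik v (x + 1) \<le> v y + h y x" for y
      using lax_oleinik_upper[OF assms, of "x + 1" "y + 1"] v shift by simp
  qed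
  moreover have "lax_oleinik v x \<le> lax_oleinik v (x + 1)"
  proof (rule lax_oleinik_greatest)
    show "lax_oleinik v x \<le> v y + h y (x + 1)" for y
      using lax_oleinik_upper[OF assms, of x "y - 1"] v[of "y - 1"] shift[of "y - 1" x] by simp
  qed
  ultimately show ?thesis by simp
qed

text \<open>The constant does not depend on v. By periodicity of v, a competitor y far from x may be replaced
  by an integer translate at distance at most 1, which is cheaper by coercivity; so only the kernel on a
  fixed strip matters.\<close>

lemma lax_oleinik_lipschitz:
  "\<exists>L\<ge>0. \<forall>v x x'. bounded_periodic v \<longrightarrow> \<bar>x' - x\<bar> \<le> 1 \<longrightarrow> \<bar>lax_oleinik v x' - lax_oleinik v x\<bar> \<le> L * \<bar>x' - x\<bar>"
proof -
  obtain K where K: "\<And>x y. \<bar>y - x\<bar> - K \<le> h x y" using coercive by blast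
  obtain K1 where K1: "\<And>x y. \<bar>y - x\<bar> \<le> 1 \<Longrightarrow> \<bar>h x y\<bar> \<le> K1"
    using diagonal_periodic_bounded[OF cont shift, of 1] by auto
  \<comment> \<open>Beyond distance R the kernel exceeds K1, a bound for it at distance at most 1.\<close>
  define R where "R = max 1 (K1 + K)"
  obtain L where L: "\<And>x y. \<bar>y - x\<bar> \<le> R + 1 \<Longrightarrow> \<bar>h2 x y\<bar> \<le> L"
    using diagonal_periodic_bounded[OF cont2 h2_shift, of "R + 1"] by auto
  have L0: "L \<ge> 0" using L[of 0 0] by (simp add: R_def)
  have half: "lax_oleinik v x' \<le> lax_oleinik v x + L * \<bar>x' - x\<bar>"
    if v: "bounded_periodic v" and x: "\<bar>x' - x\<bar> \<le> 1" for v x x'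
  proof -
    have "lax_oleinik v x' - L * \<bar>x' - x\<bar> \<le> lax_oleinik v x"
    proof (rule lax_oleinik_greatest)
      fix y
      obtain y0 where y0: "v y0 = v y" "h y0 x \<le> h y x" "\<bar>y0 - x\<bar> \<le> R"
      proof (cases "\<bar>y - x\<bar> \<le> R")
        case True
        then show ?thesis using that[of y] by simp
      next
        case False
        obtain k where k: "\<bar>y + of_int k - x\<bar> \<le> 1" using near_shift by blast
        have "h (y + of_int k) x \<le> K1" using K1[of x "y + of_int k"] k by (simp add: abs_minus_commute)
        also have "K1 \<le> h y x" using K[of x y] False by (simp add: R_def abs_minus_commute)
        finally show ?thesis
          using that[of "y + of_int k"] bounded_periodic_int[OF v] k by (simp add: R_def)
      qed
      have "norm (h y0 x' - h y0 x) \<le> L * norm (x' - x)"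
      proof (rule field_differentiable_bound[of "{y0 - (R + 1)..y0 + (R + 1)}"])
        show "((\<lambda>t. h y0 t) has_field_derivative h2 y0 t) (at t within {y0 - (R + 1)..y0 + (R + 1)})" for t
          using deriv2 by (rule has_field_derivative_at_within)
        show "norm (h2 y0 t) \<le> L" if "t \<in> {y0 - (R + 1)..y0 + (R + 1)}" for t
          using L[of t y0] that by (simp add: abs_le_iff)
      qed (use x y0(3) in \<open>auto simp: abs_le_iff\<close>)
      then show "lax_oleinik v x' - L * \<bar>x' - x\<bar> \<le> v y + h y x"
        using lax_oleinik_upper[OF v, of x' y0] y0 by (simp add: abs_le_iff)
    qed
    then show ?thesis by simp
  qed
  have "\<bar>lax_oleinik v x' - lax_oleinik v x\<bar> \<le> L * \<bar>x' - x\<bar>"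
    if "bounded_periodic v" "\<bar>x' - x\<bar> \<le> 1" for v x x'
    using half[OF that] half[of v x x'] that by (simp add: abs_le_iff abs_minus_commute)
  then show ?thesis using L0 by blast
qed

lemma lax_oleinik_oscillation:
  "\<exists>L\<ge>0. \<forall>v x x'. bounded_periodic v \<longrightarrow> \<bar>lax_oleinik v x' - lax_oleinik v x\<bar> \<le> L"
proof -
  obtain L where L: "L \<ge> 0"
    "\<And>v x x'. bounded_periodic v \<Longrightarrow> \<bar>x' - x\<bar> \<le> 1 \<Longrightarrow> \<bar>lax_oleinik v x' - lax_oleinik v x\<bar> \<le> L * \<bar>x' - x\<bar>"
    using lax_oleinik_lipschitz by blast
  have "\<bar>lax_oleinik v x' - lax_oleinik v x\<bar> \<le> L" if v: "bounded_periodic v" for v x x'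
  proof -
    obtain k where k: "\<bar>x' + of_int k - x\<bar> \<le> 1" using near_shift by blast
    have "lax_oleinik v (x' + of_int k) = lax_oleinik v x'" using lax_oleinik_periodic[OF v] by (rule periodic_shift_int)
    then have "\<bar>lax_oleinik v x' - lax_oleinik v x\<bar> \<le> L * \<bar>x' + of_int k - x\<bar>" using L(2)[OF v k] by simp
    also have "\<dots> \<le> L" using k L(1) by (simp add: mult_left_le)
    finally show ?thesis .
  qed
  then show ?thesis using L(1) by blast
qed

lemma lax_oleinik_bounded_periodic:
  assumes "bounded_periodic v"
  shows "bounded_periodic (lax_oleinik v)"
proof -
  obtain L where L: "\<And>v x x'. bounded_periodic v \<Longrightarrow> \<bar>lax_oleinik v x' - lax_oleinik v x\<bar> \<le> L"
    using lax_oleinik_oscillation by blast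
  have "\<bar>lax_oleinik v x\<bar> \<le> L + \<bar>lax_oleinik v 0\<bar>" for x using L[OF assms, of x 0] by linarith
  then show ?thesis using lax_oleinik_periodic[OF assms] by (auto simp: bounded_periodic_def periodic1_def)
qed

lemma lax_oleinik_continuous:
  assumes "bounded_periodic v"
  shows "continuous_on UNIV (lax_oleinik v)"
  using lax_oleinik_lipschitz assms by (metis locally_lipschitz_continuous)

definition weak_kam :: "real \<Rightarrow> (real \<Rightarrow> real) \<Rightarrow> bool" where
  "weak_kam s u \<longleftrightarrow> continuous_on UNIV u \<and> periodic1 u \<and> (\<forall>x. u x = lax_oleinik u x - s)"

lemma weak_kam_bounded_periodic: "weak_kam s u \<Longrightarrow> bounded_periodic u"
  unfolding weak_kam_def bounded_periodic_def by (blast intro: periodic_continuous_bounded)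

lemma iterates_bounded_periodic:
  assumes "bounded_periodic v"
  shows "bounded_periodic ((lax_oleinik ^^ n) v)"
  by (induction n) (auto intro: lax_oleinik_bounded_periodic assms)

lemma iterates_mono:
  assumes "bounded_periodic v" "\<And>x. v x \<le> w x + k"
  shows "(lax_oleinik ^^ n) v x \<le> (lax_oleinik ^^ n) w x + k"
  by (induction n arbitrary: x)
    (auto intro: assms lax_oleinik_mono iterates_bounded_periodic)

text \<open>The oscillation of the iterates is bounded uniformly, and the operator is monotone and commutes
  with constants; hence their values at 0 are quasi-additive and grow linearly up to a bounded error.\<close>

lemma critical_growth:
  "\<exists>s B. \<forall>n x. \<bar>(lax_oleinik ^^ n) (\<lambda>_. 0) x - real n * s\<bar> \<le> B"
proof -
  have bp0: "bounded_periodic (\<lambda>_. 0)" by (auto simp: bounded_periodic_def periodic1_def)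
  obtain L where L: "L \<ge> 0" "\<And>v x x'. bounded_periodic v \<Longrightarrow> \<bar>lax_oleinik v x' - lax_oleinik v x\<bar> \<le> L"
    using lax_oleinik_oscillation by blast
  define w where "w n = (lax_oleinik ^^ n) (\<lambda>_. 0)" for n
  have bp: "bounded_periodic (w n)" for n unfolding w_def by (rule iterates_bounded_periodic[OF bp0])
  have osc: "\<bar>w n x - w n 0\<bar> \<le> L" for n x
    using L bp[of "n - 1"] by (cases n) (auto simp: w_def)
  have "\<bar>w (m + n) 0 - w m 0 - w n 0\<bar> \<le> L" for m n
  proof -
    have eq: "w (m + n) = (lax_oleinik ^^ m) (w n)" by (simp add: w_def funpow_add)
    have "(lax_oleinik ^^ m) (w n) 0 \<le> w m 0 + (w n 0 + L)"
      unfolding w_def[of m]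
      by (rule iterates_mono[OF bp]) (use osc in \<open>auto simp: abs_le_iff algebra_simps\<close>)
    moreover have "w m 0 \<le> (lax_oleinik ^^ m) (w n) 0 + (L - w n 0)"
      unfolding w_def[of m]
      by (rule iterates_mono[OF bp0]) (use osc in \<open>auto simp: abs_le_iff algebra_simps\<close>)
    ultimately show ?thesis by (simp add: eq abs_le_iff)
  qed
  then obtain s where s: "\<And>n. \<bar>w n 0 - real n * s\<bar> \<le> L"
    using quasi_additive_linear[of "\<lambda>n. w n 0" L] by blast
  have "\<bar>w n x - real n * s\<bar> \<le> 2 * L" for n x using s[of n] osc[of n x] by (simp add: abs_le_iff)
  then show ?thesis unfolding w_def by blast
qed

text \<open>The pointwise infimum of the renormalised iterates works: the renormalised operator sends it to
  a function above the infimum of the later iterates alone, which is not smaller.\<close>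

lemma subsolution_exists:
  "\<exists>s v B. bounded_periodic v \<and> (\<forall>x. v x \<le> lax_oleinik v x - s) \<and> (\<forall>n x. (lax_oleinik ^^ n) v x - real n * s \<le> B)"
proof -
  have bp0: "bounded_periodic (\<lambda>_. 0)" by (auto simp: bounded_periodic_def periodic1_def)
  define w where "w n = (lax_oleinik ^^ n) (\<lambda>_. 0)" for n
  have bp: "bounded_periodic (w n)" for n unfolding w_def by (rule iterates_bounded_periodic[OF bp0])
  obtain s B where B: "\<And>n x. \<bar>w n x - real n * s\<bar> \<le> B"
    using critical_growth unfolding w_def by blast
  define v where "v x = (INF n. w n x - real n * s)" for x
  have bdd: "bdd_below (range (\<lambda>n. w n x - real n * s))" for x
    using B[of _ x] by (intro bdd_belowI[of _ "-B"]) (auto simp: abs_le_iff minus_le_iff)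
  have v_le: "v x \<le> w n x - real n * s" for x n
    unfolding v_def using bdd by (intro cINF_lower) auto
  have v_ge: "m \<le> v x" if "\<And>n. m \<le> w n x - real n * s" for x m
    unfolding v_def using that by (intro cINF_greatest) auto
  have "\<bar>v x\<bar> \<le> B" for x
  proof -
    have "-B \<le> v x"
    proof (rule v_ge)
      show "- B \<le> w n x - real n * s" for n using B[of n x] by linarith
    qed
    moreover have "v x \<le> B" using v_le[of x 0] B[of 0 x] by simp
    ultimately show ?thesis by (simp add: abs_le_iff)
  qed
  moreover have "periodic1 v"
    using bp by (simp add: v_def periodic1_def bounded_periodic_def)
  ultimately have bpv: "bounded_periodic v" by (auto simp: bounded_periodic_def)
  have "v x + s \<le> lax_oleinik v x" for x
  proof (rule lax_oleinik_greatest)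
    fix y
    have "v x + s - h y x \<le> v y"
    proof (rule v_ge)
      fix n
      have "v x \<le> w (Suc n) x - real (Suc n) * s" by (rule v_le)
      also have "w (Suc n) x \<le> w n y + h y x" using lax_oleinik_upper[OF bp[of n], of x y] by (simp add: w_def)
      finally show "v x + s - h y x \<le> w n y - real n * s" by (simp add: algebra_simps)
    qed
    then show "v x + s \<le> v y + h y x" by simp
  qed
  moreover have "(lax_oleinik ^^ n) v x - real n * s \<le> B" for n x
  proof -
    have "(lax_oleinik ^^ n) v x \<le> w n x + 0"
      unfolding w_def by (rule iterates_mono[OF bpv]) (use v_le[of _ 0] in \<open>simp add: w_def\<close>)
    then show ?thesis using B[of n x] by (simp add: abs_le_iff)
  qed
  ultimately show ?thesis using bpv by (metis le_diff_eq)
qed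

text \<open>Starting from a subsolution, the renormalised iterates increase and stay bounded, so they
  converge. They are equi-Lipschitz, hence the limit is continuous and minimisers of the approximations
  accumulate at a point that realises the infimum for the limit.\<close>

theorem weak_kam_exists: "\<exists>s u. weak_kam s u"
proof -
  obtain s v B where v: "bounded_periodic v" "\<And>x. v x \<le> lax_oleinik v x - s"
    and B: "\<And>n x. (lax_oleinik ^^ n) v x - real n * s \<le> B" using subsolution_exists by blast
  define V where "V n x = (lax_oleinik ^^ n) v x - real n * s" for n x
  have bpT: "bounded_periodic ((lax_oleinik ^^ n) v)" for n by (rule iterates_bounded_periodic[OF v(1)])
  have V_Suc: "V (Suc n) x \<le> V n y + h y x - s" for n x y
    using lax_oleinik_upper[OF bpT, of n x y] by (simp add: V_def algebra_simps)
  have V_ge: "m \<le> V (Suc n) x" if "\<And>y. m \<le> V n y + h y x - s" for m n x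
    using lax_oleinik_greatest[of "m + s + real n * s" "(lax_oleinik ^^ n) v" x] that
    by (simp add: V_def algebra_simps)
  have step: "V n x \<le> V (Suc n) x" for n x
  proof (induction n arbitrary: x)
    case 0
    show ?case using v(2)[of x] by (simp add: V_def)
  next
    case (Suc n)
    show ?case
    proof (rule V_ge)
      show "V (Suc n) x \<le> V (Suc n) y + h y x - s" for y
        using V_Suc[of n x y] Suc[of y] by simp
    qed
  qed
  have inc: "incseq (\<lambda>n. V n x)" for x using step by (rule incseq_SucI)
  define u where "u x = lim (\<lambda>n. V n x)" for x
  have lim: "(\<lambda>n. V n x) \<longlonglongrightarrow> u x" for x
  proof -
    obtain l where "(\<lambda>n. V n x) \<longlonglongrightarrow> l"
      using incseq_convergent[OF inc[of x], of B] B[of _ x] unfolding V_def by metis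
    then show ?thesis by (simp add: u_def limI)
  qed
  have V_le: "V n x \<le> u x" for n x using inc lim by (rule incseq_le)
  obtain L where L: "L \<ge> 0"
    "\<And>v x x'. bounded_periodic v \<Longrightarrow> \<bar>x' - x\<bar> \<le> 1 \<Longrightarrow> \<bar>lax_oleinik v x' - lax_oleinik v x\<bar> \<le> L * \<bar>x' - x\<bar>"
    using lax_oleinik_lipschitz by blast
  have V_lip: "\<bar>V (Suc n) x' - V (Suc n) x\<bar> \<le> L * \<bar>x' - x\<bar>" if "\<bar>x' - x\<bar> \<le> 1" for n x x'
    using L(2)[OF bpT that, of n] by (simp add: V_def)
  have "\<bar>u x' - u x\<bar> \<le> L * \<bar>x' - x\<bar>" if "\<bar>x' - x\<bar> \<le> 1" for x x'
  proof (rule LIMSEQ_le_const2)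
    show "(\<lambda>n. \<bar>V n x' - V n x\<bar>) \<longlonglongrightarrow> \<bar>u x' - u x\<bar>" by (intro tendsto_intros lim)
    show "\<exists>N. \<forall>n\<ge>N. \<bar>V n x' - V n x\<bar> \<le> L * \<bar>x' - x\<bar>"
      using V_lip[OF that] by (intro exI[of _ 1]) (auto simp: Suc_le_eq gr0_conv_Suc)
  qed
  then have ucont: "continuous_on UNIV u" by (rule locally_lipschitz_continuous)
  have "V n (x + 1) = V n x" for n x
    using bpT[of n] by (simp add: V_def bounded_periodic_def periodic1_def)
  then have uper: "periodic1 u" by (simp add: periodic1_def u_def)
  have bpu: "bounded_periodic u"
    unfolding bounded_periodic_def using uper periodic_continuous_bounded[OF ucont uper] by blast
  have ge: "u x \<le> lax_oleinik u x - s" for x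
  proof -
    have "u x + s \<le> lax_oleinik u x"
    proof (rule lax_oleinik_greatest)
      fix y
      have "u x \<le> u y + h y x - s"
      proof (rule LIMSEQ_le)
        show "(\<lambda>n. V (Suc n) x) \<longlonglongrightarrow> u x" using lim by (rule LIMSEQ_Suc)
        show "(\<lambda>n. V n y + h y x - s) \<longlonglongrightarrow> u y + h y x - s" by (intro tendsto_intros lim)
      qed (use V_Suc in blast)
      then show "u x + s \<le> u y + h y x" by simp
    qed
    then show ?thesis by simp
  qed
  have le: "lax_oleinik u x - s \<le> u x" for x
  proof -
    have Vbp: "\<exists>b. \<forall>x. \<bar>V (Suc n) x\<bar> \<le> b" for n
    proof -
      obtain b where b: "\<And>x. \<bar>(lax_oleinik ^^ Suc n) v x\<bar> \<le> b"
        using bpT[of "Suc n"] unfolding bounded_periodic_def by blast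
      have "\<bar>V (Suc n) x\<bar> \<le> b + \<bar>real (Suc n) * s\<bar>" for x using b[of x] unfolding V_def by linarith
      then show ?thesis by blast
    qed
    have "\<exists>y. \<forall>z. V (Suc n) y + h y x \<le> V (Suc n) z + h z x" for n
    proof -
      obtain b where "\<And>x. \<bar>V (Suc n) x\<bar> \<le> b" using Vbp by blast
      moreover have "continuous_on UNIV (V (Suc n))"
        using V_lip by (rule locally_lipschitz_continuous)
      ultimately show ?thesis by (intro min_attained)
    qed
    then obtain y where y: "\<And>n z. V (Suc n) (y n) + h (y n) x \<le> V (Suc n) z + h z x" by metis
    have yV: "V (Suc n) (y n) + h (y n) x - s \<le> u x" for n
    proof -
      have "V (Suc n) (y n) + h (y n) x - s \<le> V (Suc (Suc n)) x"
        by (rule V_ge) (use y[of n] in simp)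
      then show ?thesis using V_le[of "Suc (Suc n)" x] by simp
    qed
    obtain K where K: "\<And>x y. \<bar>y - x\<bar> - K \<le> h x y" using coercive by blast
    obtain b where b: "\<And>x. \<bar>v x\<bar> \<le> b" using v(1) unfolding bounded_periodic_def by blast
    have "- b \<le> V n x" for n x
    proof -
      have "V 0 x \<le> V n x" using incseqD[OF inc[of x], of 0 n] by simp
      then show ?thesis using b[of x] by (simp add: V_def abs_le_iff)
    qed
    then have "\<bar>x - y n\<bar> \<le> u x + s + b + K" for n
      using yV[of n] K[of x "y n"] by (smt (verit))
    then have "y n \<in> {x - (u x + s + b + K)..x + (u x + s + b + K)}" for n
      by (simp add: abs_le_iff) (smt (verit))
    then obtain l r where r: "strict_mono (r :: nat \<Rightarrow> nat)" "(y \<circ> r) \<longlonglongrightarrow> l"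
      using compact_Icc[unfolded compact_def, rule_format, of y] by blast
    have "u l + h l x - s \<le> u x"
    proof (rule LIMSEQ_le_const2)
      have subaction: "(\<lambda>n. V (Suc (r n)) l) \<longlonglongrightarrow> u l"
        using LIMSEQ_subseq_LIMSEQ[OF LIMSEQ_Suc[OF lim[of l]] r(1)] by (simp add: o_def)
      have yl: "(\<lambda>n. y (r n)) \<longlonglongrightarrow> l" using r(2) by (simp add: o_def)
      have hl: "(\<lambda>n. h (y (r n)) x) \<longlonglongrightarrow> h l x"
        by (rule continuous_on_tendsto_compose[OF cont_fst[of UNIV] yl]) auto
      have "(\<lambda>n. V (Suc (r n)) l - L * \<bar>y (r n) - l\<bar> + h (y (r n)) x - s)
          \<longlonglongrightarrow> u l - L * \<bar>l - l\<bar> + h l x - s"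
        by (intro tendsto_intros subaction hl yl)
      then show "(\<lambda>n. V (Suc (r n)) l - L * \<bar>y (r n) - l\<bar> + h (y (r n)) x - s)
          \<longlonglongrightarrow> u l + h l x - s" by simp
      have "\<forall>\<^sub>F n in sequentially. \<bar>y (r n) - l\<bar> < 1"
        using yl by (auto simp: tendsto_iff dist_real_def)
      then obtain N where N: "\<And>n. n \<ge> N \<Longrightarrow> \<bar>y (r n) - l\<bar> < 1"
        by (auto simp: eventually_sequentially)
      show "\<exists>N. \<forall>n\<ge>N. V (Suc (r n)) l - L * \<bar>y (r n) - l\<bar> + h (y (r n)) x - s \<le> u x"
      proof (intro exI allI impI)
        fix n assume "n \<ge> N"
        then have "\<bar>V (Suc (r n)) (y (r n)) - V (Suc (r n)) l\<bar> \<le> L * \<bar>y (r n) - l\<bar>"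
          using N[of n] by (intro V_lip) simp
        then show "V (Suc (r n)) l - L * \<bar>y (r n) - l\<bar> + h (y (r n)) x - s \<le> u x"
          using yV[of "r n"] by linarith
      qed
    qed
    then show ?thesis using lax_oleinik_upper[OF bpu, of x l] by simp
  qed
  have "weak_kam s u" unfolding weak_kam_def using ucont uper ge le by (simp add: order_antisym)
  then show ?thesis by blast
qed

text \<open>Evaluate the two fixed point equations where the difference of the two functions is maximal.\<close>

lemma weak_kam_value_le:
  assumes u: "weak_kam s u" and v: "weak_kam s' v"
  shows "s \<le> s'"
proof -
  have cont: "continuous_on {0..1} (\<lambda>x. u x - v x)"
    using u v unfolding weak_kam_def by (blast intro: continuous_on_diff continuous_on_subset)
  obtain x0 where x0: "\<And>x. x \<in> {0..1} \<Longrightarrow> u x - v x \<le> u x0 - v x0"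
    using continuous_attains_sup[OF compact_Icc _ cont] by force
  have max: "u x \<le> v x + (u x0 - v x0)" for x
  proof -
    have "u (x + of_int (- \<lfloor>x\<rfloor>)) = u x" "v (x + of_int (- \<lfloor>x\<rfloor>)) = v x"
      using weak_kam_bounded_periodic u v bounded_periodic_int by blast+
    moreover have "x + of_int (- \<lfloor>x\<rfloor>) \<in> {0..1}" by simp linarith
    ultimately show ?thesis using x0[of "x + of_int (- \<lfloor>x\<rfloor>)"] by simp
  qed
  have "lax_oleinik u x0 \<le> lax_oleinik v x0 + (u x0 - v x0)"
    using weak_kam_bounded_periodic[OF u] max by (rule lax_oleinik_mono)
  then show ?thesis using u v unfolding weak_kam_def by (smt (verit))
qed

lemma weak_kam_value_unique: "weak_kam s u \<Longrightarrow> weak_kam s' v \<Longrightarrow> s = s'"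
  using weak_kam_value_le by (meson order_antisym)

end

section \<open>Sub-actions, calibrated steps and singularities\<close>

context twist_kernel
begin

text \<open>The deficit of a step from x to y. It is nonnegative for a sub-action, and its sum along a chain
  is the action of the chain renormalised by s up to a boundary term; steps with zero deficit are the calibrated
  ones.\<close>

definition gap :: "real \<Rightarrow> (real \<Rightarrow> real) \<Rightarrow> real \<Rightarrow> real \<Rightarrow> real" where
  "gap s u x y = h x y - s - (u y - u x)"

definition subaction :: "real \<Rightarrow> (real \<Rightarrow> real) \<Rightarrow> bool" where
  "subaction s u \<longleftrightarrow> continuous_on UNIV u \<and> periodic1 u \<and> (\<forall>x y. 0 \<le> gap s u x y)"

text \<open>The pairs (x, y) by which the projected Aubry set is defined.\<close>

definition tight :: "real \<Rightarrow> real \<Rightarrow> real \<Rightarrow> bool" where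
  "tight s x y \<longleftrightarrow> (\<forall>u. subaction s u \<longrightarrow> gap s u x y = 0)"

definition forward_max :: "(real \<Rightarrow> real) \<Rightarrow> real \<Rightarrow> real \<Rightarrow> bool" where
  "forward_max u x y \<longleftrightarrow> (\<forall>z. u z - h x z \<le> u y - h x y)"

lemma subaction_bounded_periodic: "subaction s u \<Longrightarrow> bounded_periodic u"
  unfolding subaction_def bounded_periodic_def by (blast intro: periodic_continuous_bounded)

lemma gap_shift_int:
  "bounded_periodic u \<Longrightarrow> gap s u (x + of_int k) (y + of_int k) = gap s u x y"
  by (simp add: gap_def shift_int bounded_periodic_int)

lemma tight_shift_int: "tight s x y \<Longrightarrow> tight s (x + of_int k) (y + of_int k)"
  by (simp add: tight_def gap_shift_int subaction_bounded_periodic)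

lemma gap_tendsto:
  assumes u: "continuous_on UNIV u" and x: "(x \<longlongrightarrow> a) F" and y: "(y \<longlongrightarrow> b) F"
  shows "((\<lambda>n. gap s u (x n) (y n)) \<longlongrightarrow> gap s u a b) F"
proof -
  have "((\<lambda>n. h (x n) (y n)) \<longlongrightarrow> h a b) F"
    using continuous_on_tendsto_compose[OF cont tendsto_Pair[OF x y]] by simp
  moreover have "((\<lambda>n. u (x n)) \<longlongrightarrow> u a) F" "((\<lambda>n. u (y n)) \<longlongrightarrow> u b) F"
    using continuous_on_tendsto_compose[OF u x] continuous_on_tendsto_compose[OF u y] by simp_all
  ultimately show ?thesis unfolding gap_def by (intro tendsto_intros)
qed

lemma weak_kam_subaction:
  assumes "weak_kam s u"
  shows "subaction s u"
proof -
  have "0 \<le> gap s u x y" for x y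
    using lax_oleinik_upper[OF weak_kam_bounded_periodic[OF assms], of y x] assms
    unfolding weak_kam_def gap_def by (smt (verit))
  then show ?thesis using assms unfolding subaction_def weak_kam_def by blast
qed

lemma weak_kam_predecessor:
  assumes "weak_kam s u"
  shows "\<exists>z. gap s u z x = 0"
proof -
  obtain B where "\<And>x. \<bar>u x\<bar> \<le> B"
    using weak_kam_bounded_periodic[OF assms] by (auto simp: bounded_periodic_def)
  then obtain z where z: "\<And>y. u z + h z x \<le> u y + h y x"
    using min_attained assms unfolding weak_kam_def by blast
  have "lax_oleinik u x = u z + h z x"
    using lax_oleinik_greatest[of "u z + h z x" u x] z lax_oleinik_upper[OF weak_kam_bounded_periodic[OF assms], of x z]
    by (meson order_antisym)
  moreover have "u x = lax_oleinik u x - s" using assms by (simp add: weak_kam_def)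
  ultimately have "gap s u z x = 0" unfolding gap_def by linarith
  then show ?thesis by blast
qed

text \<open>The calibrated step into x provides a smooth function above u touching it at x, the calibrated
  step out of x one below.\<close>

lemma calibrated_differentiable:
  assumes u: "subaction s u" and zx: "gap s u z x = 0" and xy: "gap s u x y = 0"
  shows "(u has_real_derivative h2 z x) (at x)" "h2 z x = - h1 x y"
proof -
  have nonneg: "0 \<le> gap s u a b" for a b using u by (simp add: subaction_def)
  have g: "((\<lambda>w. u z + h z w - s) has_real_derivative h2 z x) (at x)"
    by (auto intro!: derivative_eq_intros deriv2)
  have k: "((\<lambda>w. u y - h w y + s) has_real_derivative - h1 x y) (at x)"
    by (auto intro!: derivative_eq_intros deriv1)
  have ug: "u w \<le> u z + h z w - s" for w using nonneg[of z w] by (simp add: gap_def)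
  have ku: "u y - h w y + s \<le> u w" for w using nonneg[of w y] by (simp add: gap_def)
  have eq: "u z + h z x - s = u x" "u y - h x y + s = u x" using zx xy by (simp_all add: gap_def)
  show "(u has_real_derivative h2 z x) (at x)" "h2 z x = - h1 x y"
    using has_derivative_squeeze[OF g k ug ku eq] by simp_all
qed

lemma gap_zero_forward_max: "subaction s u \<Longrightarrow> gap s u x y = 0 \<Longrightarrow> forward_max u x y"
  unfolding subaction_def forward_max_def gap_def by (smt (verit))

lemma forward_max_derivative:
  assumes "forward_max u x y" "(u has_real_derivative d) (at y)"
  shows "d = h2 x y"
proof (rule touching_derivative_eq[OF assms(2)])
  show "((\<lambda>w. h x w + (u y - h x y)) has_real_derivative h2 x y) (at y)"
    by (auto intro!: derivative_eq_intros deriv2)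
  show "u w \<le> h x w + (u y - h x y)" for w
    using assms(1) unfolding forward_max_def by (smt (verit))
qed simp

text \<open>If u had a derivative at y, it would be h2 x y because y is a maximiser, and h2 z y for a calibrated
  predecessor z of y. The twist condition forces z = x, so the step from x to y is calibrated; as x has
  a calibrated predecessor too, u would be differentiable at x.\<close>

theorem forward_max_singular:
  assumes u: "weak_kam s u" and xy: "forward_max u x y" and x: "\<not> u differentiable (at x)"
  shows "\<not> u differentiable (at y)"
proof
  assume "u differentiable (at y)"
  then obtain d where d: "(u has_real_derivative d) (at y)"
    by (auto simp: real_differentiable_def)
  obtain z where z: "gap s u z y = 0" using weak_kam_predecessor[OF u] by blast
  have "h2 z y = h2 x y"
    using forward_max_derivative[OF xy d] z
      forward_max_derivative[OF gap_zero_forward_max[OF weak_kam_subaction[OF u] z] d] by simp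
  then have "gap s u x y = 0" using z h2_inj by metis
  moreover obtain w where "gap s u w x = 0" using weak_kam_predecessor[OF u] by blast
  ultimately have "(u has_real_derivative h2 w x) (at x)"
    using calibrated_differentiable[OF weak_kam_subaction[OF u]] by blast
  then show False using x by (auto simp: real_differentiable_def)
qed

lemma forward_max_mono:
  assumes "forward_max u x y" "forward_max u x' y'" "x < x'"
  shows "y \<le> y'"
proof (rule ccontr)
  assume "\<not> y \<le> y'"
  then have "h x y' + h x' y < h x y + h x' y'" using crossing_strict[of x x' y' y] assms(3) by simp
  moreover have "u y' - h x y' \<le> u y - h x y" "u y - h x' y \<le> u y' - h x' y'"
    using assms(1,2) by (simp_all add: forward_max_def)
  ultimately show False by simp
qed

lemma lax_oleinik_subaction:
  assumes "subaction s u"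
  shows "subaction s (\<lambda>x. lax_oleinik u x - s)" "u x \<le> lax_oleinik u x - s"
proof -
  have bp: "bounded_periodic u" using assms by (rule subaction_bounded_periodic)
  have le: "u x \<le> lax_oleinik u x - s" for x
  proof -
    have "u x + s \<le> lax_oleinik u x"
    proof (rule lax_oleinik_greatest)
      show "u x + s \<le> u y + h y x" for y
        using assms unfolding subaction_def gap_def by (smt (verit))
    qed
    then show ?thesis by simp
  qed
  show "u x \<le> lax_oleinik u x - s" by (rule le)
  have "0 \<le> gap s (\<lambda>x. lax_oleinik u x - s) x y" for x y
    using lax_oleinik_upper[OF bp, of y x] le[of x] by (simp add: gap_def)
  moreover have "continuous_on UNIV (\<lambda>x. lax_oleinik u x - s)"
    by (intro continuous_intros lax_oleinik_continuous bp)
  ultimately show "subaction s (\<lambda>x. lax_oleinik u x - s)"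
    using lax_oleinik_bounded_periodic[OF bp] by (simp add: subaction_def bounded_periodic_def periodic1_def)
qed

text \<open>If u has no calibrated predecessor at x, one application of the renormalised operator raises the
  value at x strictly. The result is again a sub-action, and the step from x to y bounds its value at
  y in terms of the old value at x; so its deficit at (x, y) would be positive.\<close>

lemma tight_calibrated_predecessor:
  assumes xy: "tight s x y" and u: "subaction s u"
  shows "\<exists>z. gap s u z x = 0"
proof -
  have bp: "bounded_periodic u" using u by (rule subaction_bounded_periodic)
  then obtain B where "\<And>x. \<bar>u x\<bar> \<le> B" by (auto simp: bounded_periodic_def)
  then obtain z where z: "\<And>y. u z + h z x \<le> u y + h y x"
    using min_attained u unfolding subaction_def by blast
  have "gap s u x y = 0" "gap s (\<lambda>x. lax_oleinik u x - s) x y = 0"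
    using xy u lax_oleinik_subaction(1)[OF u] by (auto simp: tight_def)
  then have "lax_oleinik u x - s \<le> u x" using lax_oleinik_upper[OF bp, of y x] by (simp add: gap_def)
  then have "lax_oleinik u x - s = u x" using lax_oleinik_subaction(2)[OF u, of x] by simp
  moreover have "lax_oleinik u x = u z + h z x"
    using lax_oleinik_greatest[of "u z + h z x" u x] z lax_oleinik_upper[OF bp, of x z] by (meson order_antisym)
  ultimately have "gap s u z x = 0" unfolding gap_def by linarith
  then show ?thesis by blast
qed

text \<open>A calibrated predecessor z of x satisfies h2 z x = - h1 x y, whose right-hand side does not mention the
  sub-action; by the twist condition z is the same for all of them.\<close>

lemma tight_predecessor:
  assumes xy: "tight s x y"
  shows "\<exists>z. tight s z x"
proof (cases "\<exists>u. subaction s u")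
  case True
  then obtain u where u: "subaction s u" by blast
  obtain z where z: "gap s u z x = 0" using tight_calibrated_predecessor[OF xy u] by blast
  have "gap s v z x = 0" if v: "subaction s v" for v
  proof -
    obtain z' where z': "gap s v z' x = 0" using tight_calibrated_predecessor[OF xy v] by blast
    have "h2 z x = - h1 x y" "h2 z' x = - h1 x y"
      using calibrated_differentiable(2) u v z z' xy by (auto simp: tight_def)
    then show ?thesis using h2_inj z' by metis
  qed
  then show ?thesis by (auto simp: tight_def)
qed (auto simp: tight_def)

text \<open>This is the statement on predecessors for the kernel with exchanged variables, whose sub-actions are
  the functions -u.\<close>

lemma tight_successor:
  assumes xy: "tight s x y"
  shows "\<exists>z. tight s y z"
proof -
  interpret tr: twist_kernel "\<lambda>x y. h y x" "\<lambda>x y. h2 y x" "\<lambda>x y. h1 y x" \<epsilon>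
    by (rule transposed)
  have gap: "tr.gap s (\<lambda>x. - u x) b a = gap s u a b" for u a b
    by (simp add: gap_def tr.gap_def)
  have subaction: "tr.subaction s (\<lambda>x. - u x) \<longleftrightarrow> subaction s u" for u
  proof -
    have "continuous_on UNIV (\<lambda>x. - u x) \<longleftrightarrow> continuous_on UNIV u"
      using continuous_on_minus[of UNIV u] continuous_on_minus[of UNIV "\<lambda>x. - u x"] by auto
    then show ?thesis unfolding subaction_def tr.subaction_def gap by (auto simp: periodic1_def)
  qed
  have tight: "tr.tight s b a \<longleftrightarrow> tight s a b" for a b
  proof -
    have "tight s a b" if tr: "tr.tight s b a"
      unfolding tight_def
    proof (intro allI impI)
      fix u assume "subaction s u"
      then show "gap s u a b = 0" using tr subaction gap unfolding tr.tight_def by metis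
    qed
    moreover have "tr.tight s b a" if t: "tight s a b"
      unfolding tr.tight_def
    proof (intro allI impI)
      fix v assume "tr.subaction s v"
      then show "tr.gap s v b a = 0"
        using t subaction[of "\<lambda>x. - v x"] gap[of "\<lambda>x. - v x" b a] unfolding tight_def by simp
    qed
    ultimately show ?thesis by blast
  qed
  show ?thesis using tr.tight_predecessor[of s y x] xy by (simp add: tight)
qed

lemma tight_derivative:
  assumes u: "subaction s u" and xy: "tight s x y"
  shows "(u has_real_derivative - h1 x y) (at x)" "(u has_real_derivative h2 x y) (at y)"
proof -
  obtain z where "tight s z x" using tight_predecessor[OF xy] by blast
  then show "(u has_real_derivative - h1 x y) (at x)"
    using calibrated_differentiable[OF u] xy u unfolding tight_def by metis
  obtain w where "tight s y w" using tight_successor[OF xy] by blast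
  then show "(u has_real_derivative h2 x y) (at y)"
    using calibrated_differentiable[OF u] xy u unfolding tight_def by metis
qed

lemma gap_zero_to_tight_unique:
  assumes u: "subaction s u" and ab: "tight s a b" and xb: "gap s u x b = 0"
  shows "x = a"
  using forward_max_derivative[OF gap_zero_forward_max[OF u xb] tight_derivative(2)[OF u ab]] h2_inj
  by metis

lemma gap_zero_from_tight_unique:
  assumes u: "subaction s u" and ab: "tight s a b" and ay: "gap s u a y = 0"
  shows "y = b"
proof -
  obtain z where "tight s z a" using tight_predecessor[OF ab] by blast
  then have za: "gap s u z a = 0" using u by (simp add: tight_def)
  moreover have "gap s u a b = 0" using ab u by (simp add: tight_def)
  ultimately have "h1 a y = h1 a b" using calibrated_differentiable(2)[OF u za] ay by (metis neg_equal_iff_equal)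
  then show ?thesis by (rule h1_inj)
qed

lemma chain_sum_gap:
  "(\<Sum>i<n. gap s u (x i) (x (Suc i))) = (\<Sum>i<n. h (x i) (x (Suc i))) - real n * s - (u (x n) - u (x 0))"
  by (induction n) (auto simp: gap_def algebra_simps)

lemma step_bounded_by_gap:
  assumes "subaction s u"
  shows "\<exists>K. \<forall>x y. \<bar>y - x\<bar> \<le> K + gap s u x y"
proof -
  obtain K where K: "\<And>x y. \<bar>y - x\<bar> - K \<le> h x y" using coercive by blast
  obtain B where B: "\<And>x. \<bar>u x\<bar> \<le> B"
    using subaction_bounded_periodic[OF assms] by (auto simp: bounded_periodic_def)
  have "\<bar>y - x\<bar> \<le> (K + s + 2 * B) + gap s u x y" for x y
    using K[of y x] B[of x] B[of y] unfolding gap_def by linarith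
  then show ?thesis by blast
qed

lemma backward_calibrated:
  assumes "weak_kam s u"
  shows "\<exists>y. \<forall>i. gap s u (y (Suc i)) (y i) = 0"
proof -
  have "\<exists>y. \<forall>i::nat. True \<and> gap s u (y (Suc i)) (y i) = 0"
    by (rule dependent_nat_choice) (use weak_kam_predecessor[OF assms] in auto)
  then show ?thesis by blast
qed

text \<open>Follow calibrated steps backwards from any point. For every other sub-action v the deficits along
  this orbit have bounded sums, because they telescope to a difference of values of v - u; so they tend
  to 0, and every accumulation point of the steps, modulo integer translations, has deficit 0 for all v.\<close>

lemma tight_exists:
  assumes u: "weak_kam s u"
  shows "\<exists>x y. tight s x y"
proof -
  have subu: "subaction s u" using u by (rule weak_kam_subaction)
  obtain y where y: "\<And>i::nat. gap s u (y (Suc i)) (y i) = 0" using backward_calibrated[OF u] by blast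
  have gap_0: "(\<lambda>i. gap s v (y (Suc i)) (y i)) \<longlonglongrightarrow> 0" if v: "subaction s v" for v
  proof -
    obtain Bu where Bu: "\<And>x. \<bar>u x\<bar> \<le> Bu"
      using subaction_bounded_periodic[OF subu] by (auto simp: bounded_periodic_def)
    obtain Bv where Bv: "\<And>x. \<bar>v x\<bar> \<le> Bv"
      using subaction_bounded_periodic[OF v] by (auto simp: bounded_periodic_def)
    have sum: "(\<Sum>i<n. gap s v (y (Suc i)) (y i)) = (v (y n) - u (y n)) - (v (y 0) - u (y 0))" for n
    proof (induction n)
      case (Suc n)
      then show ?case using y[of n] by (simp add: gap_def algebra_simps)
    qed simp
    have "(\<Sum>i<n. norm (gap s v (y (Suc i)) (y i))) \<le> 2 * Bv + 2 * Bu" for n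
    proof -
      have "(\<Sum>i<n. norm (gap s v (y (Suc i)) (y i))) = (\<Sum>i<n. gap s v (y (Suc i)) (y i))"
        using v by (intro sum.cong) (auto simp: subaction_def)
      then show ?thesis
        using sum[of n] Bu[of "y n"] Bu[of "y 0"] Bv[of "y n"] Bv[of "y 0"] by (simp add: abs_le_iff)
    qed
    then have "summable (\<lambda>i. gap s v (y (Suc i)) (y i))"
      by (intro summable_norm_cancel[OF bounded_imp_summable[where B = "2 * Bv + 2 * Bu"]])
        (auto simp: lessThan_Suc_atMost[symmetric] simp del: sum.lessThan_Suc)
    then show ?thesis by (rule summable_LIMSEQ_zero)
  qed
  obtain K where K: "\<And>x y. \<bar>y - x\<bar> \<le> K + gap s u x y" using step_bounded_by_gap[OF subu] by blast
  have d: "\<bar>y i - y (Suc i)\<bar> \<le> K" for i using K[of "y i" "y (Suc i)"] y[of i] by simp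
  \<comment> \<open>The steps, translated so that their end points lie in a compact set.\<close>
  define X where "X i = (y (Suc i) - of_int \<lfloor>y i\<rfloor>, y i - of_int \<lfloor>y i\<rfloor>)" for i
  have "X i \<in> {-K..1 + K} \<times> {0..1}" for i
  proof -
    have "0 \<le> y i - of_int \<lfloor>y i\<rfloor>" "y i - of_int \<lfloor>y i\<rfloor> \<le> 1" by linarith+
    moreover from this have "- K \<le> y (Suc i) - of_int \<lfloor>y i\<rfloor>" "y (Suc i) - of_int \<lfloor>y i\<rfloor> \<le> 1 + K"
      using d[of i] by linarith+
    ultimately show ?thesis unfolding X_def by simp
  qed
  moreover have "compact ({-K..1 + K} \<times> {0..1::real})" by (intro compact_Times) auto
  ultimately obtain l r where r: "strict_mono (r :: nat \<Rightarrow> nat)" "(X \<circ> r) \<longlonglongrightarrow> l"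
    unfolding compact_def by metis
  have l1: "(\<lambda>i. y (Suc (r i)) - of_int \<lfloor>y (r i)\<rfloor>) \<longlonglongrightarrow> fst l"
    using tendsto_fst[OF r(2)] by (simp add: X_def o_def)
  have l2: "(\<lambda>i. y (r i) - of_int \<lfloor>y (r i)\<rfloor>) \<longlonglongrightarrow> snd l"
    using tendsto_snd[OF r(2)] by (simp add: X_def o_def)
  have "gap s v (fst l) (snd l) = 0" if v: "subaction s v" for v
  proof (rule LIMSEQ_unique)
    show "(\<lambda>i. gap s v (y (Suc (r i)) - of_int \<lfloor>y (r i)\<rfloor>) (y (r i) - of_int \<lfloor>y (r i)\<rfloor>))
        \<longlonglongrightarrow> gap s v (fst l) (snd l)"
      using v by (intro gap_tendsto l1 l2) (simp add: subaction_def)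
    have eq: "gap s v (y (Suc i) - of_int \<lfloor>y i\<rfloor>) (y i - of_int \<lfloor>y i\<rfloor>) = gap s v (y (Suc i)) (y i)" for i
      using gap_shift_int[OF subaction_bounded_periodic[OF v], of s "y (Suc i)" "- \<lfloor>y i\<rfloor>" "y i"] by simp
    show "(\<lambda>i. gap s v (y (Suc (r i)) - of_int \<lfloor>y (r i)\<rfloor>) (y (r i) - of_int \<lfloor>y (r i)\<rfloor>)) \<longlonglongrightarrow> 0"
      unfolding eq using LIMSEQ_subseq_LIMSEQ[OF gap_0[OF v] r(1)] by (simp add: o_def)
  qed
  then show ?thesis by (auto simp: tight_def)
qed

end

section \<open>Tight orbits and the rotation number\<close>

context twist_kernel
begin

definition tight_orbit :: "real \<Rightarrow> (nat \<Rightarrow> real) \<Rightarrow> bool" where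
  "tight_orbit s a \<longleftrightarrow> (\<forall>n. tight s (a n) (a (Suc n)))"

lemma tight_orbit_exists:
  assumes "tight s x y"
  shows "\<exists>a. a 0 = x \<and> tight_orbit s a"
proof -
  have "\<exists>a. \<forall>n::nat. ((\<exists>y. tight s (a n) y) \<and> (n = 0 \<longrightarrow> a n = x)) \<and> tight s (a n) (a (Suc n))"
    by (rule dependent_nat_choice) (use assms tight_successor in blast)+
  then show ?thesis unfolding tight_orbit_def by blast
qed

lemma tight_backward_orbit_exists:
  assumes "tight s x y"
  shows "\<exists>b. b 0 = x \<and> (\<forall>n::nat. tight s (b (Suc n)) (b n))"
proof -
  have "\<exists>b. \<forall>n::nat. ((\<exists>y. tight s (b n) y) \<and> (n = 0 \<longrightarrow> b n = x)) \<and> tight s (b (Suc n)) (b n)"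
    by (rule dependent_nat_choice) (use assms tight_predecessor in blast)+
  then show ?thesis by blast
qed

lemma tight_orbit_shift_int: "tight_orbit s a \<Longrightarrow> tight_orbit s (\<lambda>n. a n + of_int k)"
  by (simp add: tight_orbit_def tight_shift_int)

text \<open>Weak monotonicity comes from the crossing inequality. It is strict because tight steps can be
  neither joined nor left by other calibrated steps.\<close>

lemma gap_zero_order_step:
  assumes u: "subaction s u" and ab: "tight s a b" and xy: "gap s u x y = 0"
  shows "a \<le> x \<Longrightarrow> b \<le> y" "x < a \<Longrightarrow> y < b"
proof -
  have gab: "gap s u a b = 0" using ab u by (simp add: tight_def)
  note fx = gap_zero_forward_max[OF u xy] and fa = gap_zero_forward_max[OF u gab]
  show "b \<le> y" if "a \<le> x"
  proof (cases "a = x")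
    case True
    then show ?thesis using gap_zero_from_tight_unique[OF u ab] xy by simp
  next
    case False
    then show ?thesis using forward_max_mono[OF fa fx] that by simp
  qed
  show "y < b" if "x < a"
  proof -
    have "y \<noteq> b" using gap_zero_to_tight_unique[OF u ab, of x] xy that by auto
    then show ?thesis using forward_max_mono[OF fx fa that] by simp
  qed
qed

text \<open>A singular point never coincides with a point of a tight orbit, where u is differentiable; this
  makes the monotonicity of maximisers strict.\<close>

lemma singular_order_step:
  assumes u: "subaction s u" and ab: "tight s a b" and xy: "forward_max u x y"
    and y: "\<not> u differentiable (at y)"
  shows "a < x \<Longrightarrow> b < y" "x < a \<Longrightarrow> y < b"
proof -
  have "gap s u a b = 0" using ab u by (simp add: tight_def)
  then have fa: "forward_max u a b" by (rule gap_zero_forward_max[OF u])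
  have "y \<noteq> b" using tight_derivative(2)[OF u ab] y by (auto simp: real_differentiable_def)
  then show "a < x \<Longrightarrow> b < y" "x < a \<Longrightarrow> y < b"
    using forward_max_mono[OF fa xy] forward_max_mono[OF xy fa] by fastforce+
qed

text \<open>The property common to calibrated chains and to chains of singular points: after n steps they
  have not overtaken any tight orbit, in either direction.\<close>

definition ordered_chain :: "real \<Rightarrow> (nat \<Rightarrow> real) \<Rightarrow> nat \<Rightarrow> bool" where
  "ordered_chain s x n \<longleftrightarrow>
     (\<forall>b. tight_orbit s b \<longrightarrow> (b 0 \<le> x 0 \<longrightarrow> b n \<le> x n) \<and> (x 0 < b 0 \<longrightarrow> x n \<le> b n))"

lemma gap_zero_ordered_chain:
  assumes u: "subaction s u" and x: "\<And>i. i < n \<Longrightarrow> gap s u (x i) (x (Suc i)) = 0"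
  shows "ordered_chain s x n"
  unfolding ordered_chain_def
proof (intro allI impI)
  fix b assume b: "tight_orbit s b"
  have "(b 0 \<le> x 0 \<longrightarrow> b m \<le> x m) \<and> (x 0 < b 0 \<longrightarrow> x m < b m)" if "m \<le> n" for m
    using that
  proof (induction m)
    case (Suc m)
    have "tight s (b m) (b (Suc m))" using b by (simp add: tight_orbit_def)
    then show ?case using gap_zero_order_step[OF u _ x[of m]] Suc by fastforce
  qed simp
  then show "(b 0 \<le> x 0 \<longrightarrow> b n \<le> x n) \<and> (x 0 < b 0 \<longrightarrow> x n \<le> b n)" by fastforce
qed

text \<open>Since singularities propagate, the strict comparison of singular points with tight orbits can be
  iterated.\<close>

lemma singular_ordered_chain:
  assumes u: "weak_kam s u" and x: "\<And>i. forward_max u (x i) (x (Suc i))"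
    and x0: "\<not> u differentiable (at (x 0))"
  shows "ordered_chain s x n"
  unfolding ordered_chain_def
proof (intro allI impI)
  fix b assume b: "tight_orbit s b"
  have sing: "\<not> u differentiable (at (x m))" for m
    by (induction m) (use x0 forward_max_singular[OF u x] in auto)
  have "(b 0 < x 0 \<longrightarrow> b m < x m) \<and> (x 0 < b 0 \<longrightarrow> x m < b m)" for m
  proof (induction m)
    case (Suc m)
    have "tight s (b m) (b (Suc m))" using b by (simp add: tight_orbit_def)
    then show ?case using singular_order_step[OF weak_kam_subaction[OF u] _ x[of m] sing] Suc by blast
  qed simp
  moreover have "b 0 \<noteq> x 0"
    using x0 b tight_derivative(1)[OF weak_kam_subaction[OF u], of "b 0" "b 1"]
    by (auto simp: tight_orbit_def real_differentiable_def)
  ultimately show "(b 0 \<le> x 0 \<longrightarrow> b n \<le> x n) \<and> (x 0 < b 0 \<longrightarrow> x n \<le> b n)"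
    by (meson less_eq_real_def)
qed

text \<open>The chain starts between two consecutive integer translates of the tight orbit, and stays
  there.\<close>

lemma ordered_chain_displacement:
  assumes a: "tight_orbit s a" and x: "ordered_chain s x n"
  shows "\<bar>(x n - x 0) - (a n - a 0)\<bar> \<le> 1"
proof -
  define k where "k = \<lfloor>x 0 - a 0\<rfloor>"
  have k: "a 0 + of_int k \<le> x 0" "x 0 < a 0 + of_int (k + 1)" unfolding k_def by linarith+
  then have "a n + of_int k \<le> x n" "x n \<le> a n + of_int (k + 1)"
    using x tight_orbit_shift_int[OF a, of k] tight_orbit_shift_int[OF a, of "k + 1"]
    unfolding ordered_chain_def by blast+
  then show ?thesis using k by (simp add: abs_le_iff)
qed

text \<open>The displacement of a tight orbit over n steps is the same up to 1 from wherever one starts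
  counting, hence quasi-additive; and every ordered chain follows a tight orbit up to 1.\<close>

theorem rotation_number_exists:
  assumes u: "weak_kam s u"
  shows "\<exists>\<rho>. \<forall>x n. ordered_chain s x n \<longrightarrow> \<bar>x n - x 0 - real n * \<rho>\<bar> \<le> 2"
proof -
  obtain a where a: "tight_orbit s a" using tight_exists[OF u] tight_orbit_exists by blast
  define b where "b n = a n - a 0" for n
  have "\<bar>b (m + n) - b m - b n\<bar> \<le> 1" for m n
  proof -
    have "ordered_chain s (\<lambda>i. a (m + i)) n"
      using a weak_kam_subaction[OF u] by (intro gap_zero_ordered_chain) (auto simp: tight_orbit_def tight_def)
    then show ?thesis using ordered_chain_displacement[OF a] by (fastforce simp: b_def)
  qed
  then obtain \<rho> where \<rho>: "\<And>n. \<bar>b n - real n * \<rho>\<bar> \<le> 1" using quasi_additive_linear by blast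
  have "\<bar>x n - x 0 - real n * \<rho>\<bar> \<le> 2" if "ordered_chain s x n" for x n
    using ordered_chain_displacement[OF a that] \<rho>[of n] unfolding b_def by linarith
  then show ?thesis by blast
qed

section \<open>Dependence of the critical value on the cohomology class\<close>

lemma chain_length_bound:
  assumes K: "\<And>x y. \<bar>y - x\<bar> \<le> K + gap s u x y"
  shows "\<bar>x n - x 0\<bar> \<le> real n * K + (\<Sum>i<n. gap s u (x i) (x (Suc i)))"
proof (induction n)
  case (Suc n)
  then show ?case using K[of "x (Suc n)" "x n"] by (simp add: algebra_simps)
qed simp

text \<open>Compactness: chains of length N violating the bound with total deficit tending to 0 would
  accumulate, after integer translations, at a calibrated chain, for which the bound 2 holds.\<close>

lemma small_gap_displacement:
  assumes u: "subaction s u"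
    and rot: "\<And>x n. ordered_chain s x n \<Longrightarrow> \<bar>x n - x 0 - real n * \<rho>\<bar> \<le> 2"
  shows "\<exists>\<delta>>0. \<forall>x. (\<Sum>i<N. gap s u (x i) (x (Suc i))) < \<delta> \<longrightarrow> \<bar>x N - x 0 - real N * \<rho>\<bar> \<le> 3"
proof (rule ccontr)
  assume "\<not> ?thesis"
  then have "\<exists>x. (\<Sum>i<N. gap s u (x i) (x (Suc i))) < 1 / real (Suc k) \<and> \<bar>x N - x 0 - real N * \<rho>\<bar> > 3" for k
    by (meson not_le of_nat_0_less_iff zero_less_Suc zero_less_divide_1_iff)
  then obtain X where X: "\<And>k. (\<Sum>i<N. gap s u (X k i) (X k (Suc i))) < 1 / real (Suc k)"
      "\<And>k. \<bar>X k N - X k 0 - real N * \<rho>\<bar> > 3" by metis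
  have nonneg: "0 \<le> gap s u a b" for a b using u by (simp add: subaction_def)
  obtain K where K: "\<And>x y. \<bar>y - x\<bar> \<le> K + gap s u x y" using step_bounded_by_gap[OF u] by blast
  \<comment> \<open>Freezing the chains after N steps makes all their entries uniformly bounded.\<close>
  define Y where "Y k i = X k (min i N) - of_int \<lfloor>X k 0\<rfloor>" for k i
  have small: "(\<Sum>i<n. gap s u (X k i) (X k (Suc i))) \<le> 1 / real (Suc k)" if "n \<le> N" for k n
  proof -
    have "(\<Sum>i<n. gap s u (X k i) (X k (Suc i))) \<le> (\<Sum>i<N. gap s u (X k i) (X k (Suc i)))"
      by (rule sum_mono2) (use that nonneg in auto)
    then show ?thesis using X(1)[of k] by simp
  qed
  have bound: "norm (Y k i) \<le> real N * \<bar>K\<bar> + 2" for k i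
  proof -
    have "\<bar>X k (min i N) - X k 0\<bar> \<le> real (min i N) * K + 1 / real (Suc k)"
      using chain_length_bound[OF K, of "X k" "min i N"] small[of "min i N" k] by simp
    also have "\<dots> \<le> real N * \<bar>K\<bar> + 1"
    proof (rule add_mono)
      have "real (min i N) * K \<le> real (min i N) * \<bar>K\<bar>" by (intro mult_left_mono) auto
      also have "\<dots> \<le> real N * \<bar>K\<bar>" by (intro mult_right_mono) auto
      finally show "real (min i N) * K \<le> real N * \<bar>K\<bar>" .
    qed simp
    finally have "\<bar>X k (min i N) - X k 0\<bar> \<le> real N * \<bar>K\<bar> + 1" .
    moreover have "0 \<le> X k 0 - of_int \<lfloor>X k 0\<rfloor>" "X k 0 - of_int \<lfloor>X k 0\<rfloor> \<le> 1" by linarith+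
    ultimately show ?thesis unfolding Y_def real_norm_def by linarith
  qed
  obtain r where r: "strict_mono (r :: nat \<Rightarrow> nat)" "\<And>i. \<exists>l. (\<lambda>k. Y (r k) i) \<longlonglongrightarrow> l"
    using function_convergent_subsequence[of UNIV Y "real N * \<bar>K\<bar> + 2"] bound by auto
  obtain l where l: "\<And>i. (\<lambda>k. Y (r k) i) \<longlonglongrightarrow> l i" using r(2) by metis
  have "gap s u (l i) (l (Suc i)) = 0" if i: "i < N" for i
  proof (rule LIMSEQ_unique)
    show "(\<lambda>k. gap s u (Y (r k) i) (Y (r k) (Suc i))) \<longlonglongrightarrow> gap s u (l i) (l (Suc i))"
      using u by (intro gap_tendsto l) (simp add: subaction_def)
    have le: "gap s u (Y k i) (Y k (Suc i)) \<le> 1 / real (Suc k)" for k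
    proof -
      have "gap s u (Y k i) (Y k (Suc i)) = gap s u (X k i) (X k (Suc i))"
        using gap_shift_int[OF subaction_bounded_periodic[OF u], of s "X k i" "- \<lfloor>X k 0\<rfloor>" "X k (Suc i)"] i
        by (simp add: Y_def Suc_le_eq min_absorb1)
      also have "\<dots> \<le> (\<Sum>i<N. gap s u (X k i) (X k (Suc i)))"
        by (rule member_le_sum) (use i nonneg in auto)
      also have "\<dots> \<le> 1 / real (Suc k)" using X(1)[of k] by simp
      finally show ?thesis .
    qed
    have lim: "(\<lambda>k. 1 / real (Suc (r k))) \<longlonglongrightarrow> 0"
      using LIMSEQ_subseq_LIMSEQ[OF lim_1_over_n[THEN LIMSEQ_Suc] r(1)] by (simp add: o_def)
    show "(\<lambda>k. gap s u (Y (r k) i) (Y (r k) (Suc i))) \<longlonglongrightarrow> 0"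
      by (rule tendsto_sandwich[OF _ _ tendsto_const lim]) (use nonneg le in auto)
  qed
  then have "\<bar>l N - l 0 - real N * \<rho>\<bar> \<le> 2" by (intro rot gap_zero_ordered_chain[OF u])
  moreover have "3 \<le> \<bar>l N - l 0 - real N * \<rho>\<bar>"
  proof (rule LIMSEQ_le_const)
    show "(\<lambda>k. \<bar>Y (r k) N - Y (r k) 0 - real N * \<rho>\<bar>) \<longlonglongrightarrow> \<bar>l N - l 0 - real N * \<rho>\<bar>"
      by (intro tendsto_intros l)
    show "\<exists>M. \<forall>k\<ge>M. 3 \<le> \<bar>Y (r k) N - Y (r k) 0 - real N * \<rho>\<bar>"
      using X(2) by (auto simp: Y_def intro: less_imp_le)
  qed
  ultimately show False by simp
qed

text \<open>Chains of small total deficit are covered by compactness. When the deficit is not small, coercivity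
  bounds the distance travelled by a constant plus the deficit, and a large factor C absorbs the constant.\<close>

lemma block_displacement:
  assumes u: "subaction s u"
    and rot: "\<And>x n. ordered_chain s x n \<Longrightarrow> \<bar>x n - x 0 - real n * \<rho>\<bar> \<le> 2"
  shows "\<exists>C\<ge>0. \<forall>x. \<bar>x N - x 0 - real N * \<rho>\<bar> \<le> 3 + C * (\<Sum>i<N. gap s u (x i) (x (Suc i)))"
proof -
  obtain \<delta> where \<delta>: "\<delta> > 0"
    "\<And>x. (\<Sum>i<N. gap s u (x i) (x (Suc i))) < \<delta> \<Longrightarrow> \<bar>x N - x 0 - real N * \<rho>\<bar> \<le> 3"
    using small_gap_displacement[OF u rot, of N] by blast
  obtain K where K: "\<And>x y. \<bar>y - x\<bar> \<le> K + gap s u x y" using step_bounded_by_gap[OF u] by blast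
  define E where "E = real N * (\<bar>K\<bar> + \<bar>\<rho>\<bar>)"
  have E: "E \<ge> 0" by (simp add: E_def)
  have "\<bar>x N - x 0 - real N * \<rho>\<bar> \<le> 3 + (E / \<delta> + 1) * (\<Sum>i<N. gap s u (x i) (x (Suc i)))" for x
  proof -
    define G where "G = (\<Sum>i<N. gap s u (x i) (x (Suc i)))"
    have G: "G \<ge> 0" unfolding G_def using u by (intro sum_nonneg) (simp add: subaction_def)
    have c: "E / \<delta> + 1 \<ge> 0" using E \<delta>(1) by simp
    show ?thesis
    proof (cases "G < \<delta>")
      case True
      then show ?thesis using \<delta>(2)[of x] mult_nonneg_nonneg[OF c G] unfolding G_def by linarith
    next
      case False
      have "\<bar>x N - x 0\<bar> \<le> real N * K + G" using chain_length_bound[OF K] by (simp add: G_def)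
      moreover have "real N * K \<le> real N * \<bar>K\<bar>" by (intro mult_left_mono) auto
      moreover have "\<bar>real N * \<rho>\<bar> = real N * \<bar>\<rho>\<bar>" by (simp add: abs_mult)
      ultimately have "\<bar>x N - x 0 - real N * \<rho>\<bar> \<le> E + G"
        unfolding E_def distrib_left by linarith
      moreover have "E \<le> E / \<delta> * G"
        using False \<delta>(1) E mult_left_mono[of \<delta> G E] by (simp add: field_simps)
      ultimately show ?thesis unfolding G_def[symmetric] by (simp add: algebra_simps)
    qed
  qed
  then show ?thesis using E \<delta>(1) by (intro exI[of _ "E / \<delta> + 1"]) simp
qed

text \<open>A chain of q blocks of length N deviates from the rotation number by at most 3 / N per step, up to a
  multiple of its total deficit. Taking N large makes the first error as small as desired.\<close>

lemma blocks_displacement: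
  assumes u: "subaction s u"
    and rot: "\<And>x n. ordered_chain s x n \<Longrightarrow> \<bar>x n - x 0 - real n * \<rho>\<bar> \<le> 2"
  shows "\<exists>C\<ge>0. \<forall>x q. \<bar>x (q * N) - x 0 - real (q * N) * \<rho>\<bar>
           \<le> 3 * real q + C * (\<Sum>i<q * N. gap s u (x i) (x (Suc i)))"
proof -
  obtain C where C: "C \<ge> 0"
    "\<And>x. \<bar>x N - x 0 - real N * \<rho>\<bar> \<le> 3 + C * (\<Sum>i<N. gap s u (x i) (x (Suc i)))"
    using block_displacement[OF u rot, of N] by blast
  have "\<bar>x (q * N) - x 0 - real (q * N) * \<rho>\<bar>
      \<le> 3 * real q + C * (\<Sum>i<q * N. gap s u (x i) (x (Suc i)))" for x q
  proof (induction q)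
    case (Suc q)
    have "(\<Sum>i<Suc q * N. gap s u (x i) (x (Suc i)))
        = (\<Sum>i<q * N. gap s u (x i) (x (Suc i))) + (\<Sum>i<N. gap s u (x (q * N + i)) (x (Suc (q * N + i))))"
      using sum_lessThan_add[of "\<lambda>i. gap s u (x i) (x (Suc i))" "q * N" N] by (simp add: add.commute)
    moreover have "\<bar>x (q * N + N) - x (q * N) - real N * \<rho>\<bar>
        \<le> 3 + C * (\<Sum>i<N. gap s u (x (q * N + i)) (x (Suc (q * N + i))))"
      using C(2)[of "\<lambda>i. x (q * N + i)"] by simp
    ultimately show ?case using Suc
      by (simp add: algebra_simps abs_le_iff)
  qed simp
  then show ?thesis using C(1) by blast
qed

text \<open>Convexity: the minimal average action of the tilted kernel is at most the average action of a tight
  orbit of the original one, and tilting changes the action of a chain by -e times its displacement.\<close>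

lemma tilted_value_lower:
  assumes u: "weak_kam s u"
    and rot: "\<And>x n. ordered_chain s x n \<Longrightarrow> \<bar>x n - x 0 - real n * \<rho>\<bar> \<le> 2"
    and v: "twist_kernel.weak_kam (\<lambda>x y. h x y + e * (x - y)) s' v"
  shows "e * \<rho> \<le> s - s'"
proof -
  interpret tl: twist_kernel "\<lambda>x y. h x y + e * (x - y)" "\<lambda>x y. h1 x y + e" "\<lambda>x y. h2 x y - e" \<epsilon>
    by (rule tilted)
  obtain a where a: "tight_orbit s a" using tight_exists[OF u] tight_orbit_exists by blast
  obtain B where B: "\<And>x. \<bar>u x\<bar> \<le> B"
    using weak_kam_bounded_periodic[OF u] by (auto simp: bounded_periodic_def)
  obtain B' where B': "\<And>x. \<bar>v x\<bar> \<le> B'"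
    using tl.weak_kam_bounded_periodic[OF v] by (auto simp: bounded_periodic_def)
  have "- (2 * B + 2 * B' + 2 * \<bar>e\<bar>) \<le> real n * (s - s' - e * \<rho>)" for n
  proof -
    have "(\<Sum>i<n. gap s u (a i) (a (Suc i))) = 0"
      using a weak_kam_subaction[OF u] by (simp add: tight_orbit_def tight_def)
    moreover have "(\<Sum>i<n. tl.gap s' v (a i) (a (Suc i))) \<ge> 0"
      using tl.weak_kam_subaction[OF v] by (intro sum_nonneg) (simp add: tl.subaction_def)
    moreover have "(\<Sum>i<n. h (a i) (a (Suc i)) + e * (a i - a (Suc i)))
        = (\<Sum>i<n. h (a i) (a (Suc i))) + e * (a 0 - a n)"
      by (induction n) (auto simp: algebra_simps)
    ultimately have "real n * s - real n * s' + e * (a 0 - a n) \<ge> v (a n) - v (a 0) - (u (a n) - u (a 0))"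
      unfolding chain_sum_gap tl.chain_sum_gap by linarith
    then have 1: "real n * (s - s' - e * \<rho>) \<ge> e * (a n - a 0 - real n * \<rho>) - 2 * B - 2 * B'"
      using B[of "a n"] B[of "a 0"] B'[of "a n"] B'[of "a 0"]
      by (simp add: algebra_simps abs_le_iff)
    have "ordered_chain s a n"
      using a weak_kam_subaction[OF u] by (intro gap_zero_ordered_chain) (auto simp: tight_orbit_def tight_def)
    then have "\<bar>e * (a n - a 0 - real n * \<rho>)\<bar> \<le> \<bar>e\<bar> * 2"
      unfolding abs_mult by (intro mult_left_mono rot) auto
    then show ?thesis using 1 by (simp only: abs_le_iff) linarith
  qed
  then show ?thesis using nonneg_of_multiples_bounded_below by fastforce
qed

text \<open>A calibrated chain for the tilted kernel, of n = q N steps, has total deficit at most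
  |e| |Delta| - n A + D for the original kernel, where Delta is its deviation from n rho, A = s - s' - e rho, and D comes
  from boundary terms. Conversely |Delta| is at most 3 q plus C times this deficit, so for small e
  it is at most 6 q up to a constant. Hence n A is at most 6 q |e| up to a constant; let q tend to infinity.\<close>

lemma tilted_value_upper:
  assumes u: "weak_kam s u"
    and rot: "\<And>x n. ordered_chain s x n \<Longrightarrow> \<bar>x n - x 0 - real n * \<rho>\<bar> \<le> 2"
    and C0: "C \<ge> 0"
    and C: "\<And>x q. \<bar>x (q * N) - x 0 - real (q * N) * \<rho>\<bar>
           \<le> 3 * real q + C * (\<Sum>i<q * N. gap s u (x i) (x (Suc i)))"
    and e: "C * \<bar>e\<bar> \<le> 1 / 2"
    and v: "twist_kernel.weak_kam (\<lambda>x y. h x y + e * (x - y)) s' v"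
  shows "real N * (s - s' - e * \<rho>) \<le> 6 * \<bar>e\<bar>"
proof -
  interpret tl: twist_kernel "\<lambda>x y. h x y + e * (x - y)" "\<lambda>x y. h1 x y + e" "\<lambda>x y. h2 x y - e" \<epsilon>
    by (rule tilted)
  obtain B where B: "\<And>x. \<bar>u x\<bar> \<le> B"
    using weak_kam_bounded_periodic[OF u] by (auto simp: bounded_periodic_def)
  obtain B' where B': "\<And>x. \<bar>v x\<bar> \<le> B'"
    using tl.weak_kam_bounded_periodic[OF v] by (auto simp: bounded_periodic_def)
  obtain y where y: "\<And>i. tl.gap s' v (y (Suc i)) (y i) = 0" using tl.backward_calibrated[OF v] by blast
  define A where "A = s - s' - e * \<rho>"
  define D where "D = 2 * B + 2 * B'"
  have A0: "A \<ge> 0" unfolding A_def using tilted_value_lower[OF u rot v] by simp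
  have D0: "D \<ge> 0" using B[of 0] B'[of 0] by (simp add: D_def)
  have telescope: "(\<Sum>i<n. h (x i) (x (Suc i)) + e * (x i - x (Suc i)))
      = (\<Sum>i<n. h (x i) (x (Suc i))) + e * (x 0 - x n)" for x :: "nat \<Rightarrow> real" and n
    by (induction n) (auto simp: algebra_simps)
  have "- (2 * D) \<le> real q * (6 * \<bar>e\<bar> - real N * A)" for q
  proof -
    define n where "n = q * N"
    \<comment> \<open>The backward calibrated orbit read forwards.\<close>
    define x where "x i = y (n - i)" for i
    define \<Delta> where "\<Delta> = x n - x 0 - real n * \<rho>"
    define G where "G = (\<Sum>i<n. gap s u (x i) (x (Suc i)))"
    have G0: "G \<ge> 0" unfolding G_def using weak_kam_subaction[OF u] by (intro sum_nonneg) (simp add: subaction_def)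
    have "tl.gap s' v (x i) (x (Suc i)) = 0" if "i < n" for i
      using y[of "n - Suc i"] that by (simp add: x_def Suc_diff_Suc)
    then have "(\<Sum>i<n. tl.gap s' v (x i) (x (Suc i))) = 0" by simp
    moreover have "(\<Sum>i<n. h (x i) (x (Suc i)) + e * (x i - x (Suc i)))
        = (\<Sum>i<n. h (x i) (x (Suc i))) + e * (x 0 - x n)"
      using telescope[of x n] by simp
    ultimately have "G = e * (x n - x 0) - real n * (s - s') + (v (x n) - v (x 0)) - (u (x n) - u (x 0))"
      unfolding G_def chain_sum_gap tl.chain_sum_gap by (simp add: algebra_simps)
    then have "G \<le> e * \<Delta> - real n * A + D"
      using B[of "x n"] B[of "x 0"] B'[of "x n"] B'[of "x 0"]
      unfolding \<Delta>_def A_def D_def by (simp add: algebra_simps abs_le_iff)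
    moreover have "e * \<Delta> \<le> \<bar>e\<bar> * \<bar>\<Delta>\<bar>" by (metis abs_ge_self abs_mult)
    ultimately have G1: "G + real n * A \<le> \<bar>e\<bar> * \<bar>\<Delta>\<bar> + D" by linarith
    have nA: "real n * A \<ge> 0" using A0 by simp
    have "C * G \<le> C * (\<bar>e\<bar> * \<bar>\<Delta>\<bar> + D)" using G1 nA C0 by (intro mult_left_mono) auto
    also have "\<dots> = (C * \<bar>e\<bar>) * \<bar>\<Delta>\<bar> + C * D" by (simp add: algebra_simps)
    also have "\<dots> \<le> 1 / 2 * \<bar>\<Delta>\<bar> + C * D" using e by (intro add_right_mono mult_right_mono) auto
    finally have "C * G \<le> 1 / 2 * \<bar>\<Delta>\<bar> + C * D" .
    moreover have "\<bar>\<Delta>\<bar> \<le> 3 * real q + C * G" using C[of x q] by (simp add: \<Delta>_def G_def n_def)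
    ultimately have "\<bar>\<Delta>\<bar> \<le> 6 * real q + 2 * (C * D)" by linarith
    then have "\<bar>e\<bar> * \<bar>\<Delta>\<bar> \<le> \<bar>e\<bar> * (6 * real q + 2 * (C * D))" by (intro mult_left_mono) auto
    also have "\<dots> = 6 * real q * \<bar>e\<bar> + 2 * ((C * \<bar>e\<bar>) * D)" by (simp add: algebra_simps)
    also have "(C * \<bar>e\<bar>) * D \<le> 1 / 2 * D" using e D0 by (intro mult_right_mono) auto
    finally have "\<bar>e\<bar> * \<bar>\<Delta>\<bar> \<le> 6 * real q * \<bar>e\<bar> + D" by simp
    then have "real n * A \<le> 6 * real q * \<bar>e\<bar> + 2 * D" using G1 G0 by linarith
    then show ?thesis by (simp add: n_def algebra_simps)
  qed
  then have "0 \<le> 6 * \<bar>e\<bar> - real N * A" by (rule nonneg_of_multiples_bounded_below)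
  then show ?thesis by (simp add: A_def)
qed

text \<open>The remainder A of the first-order expansion lies between 0 and 6 |e| / N once e is small
  enough for the given N, and N is arbitrary.\<close>

theorem value_has_derivative:
  assumes u: "weak_kam s u"
    and rot: "\<And>x n. ordered_chain s x n \<Longrightarrow> \<bar>x n - x 0 - real n * \<rho>\<bar> \<le> 2"
    and \<alpha>: "\<And>c'. \<exists>v. twist_kernel.weak_kam (\<lambda>x y. h x y + (c' - c) * (x - y)) (- \<alpha> c') v"
    and \<alpha>c: "\<alpha> c = - s"
  shows "(\<alpha> has_real_derivative \<rho>) (at c)"
  unfolding has_field_derivative_def has_derivative_at_alt
proof (intro conjI allI impI)
  show "bounded_linear ((*) \<rho>)" by (rule bounded_linear_mult_right)
  fix \<eta> :: real assume \<eta>: "0 < \<eta>"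
  obtain N where N: "real N > 6 / \<eta>" using reals_Archimedean2 by blast
  then have N0: "real N > 0" using \<eta> by (meson divide_pos_pos order_less_trans zero_less_numeral)
  obtain C where C: "C \<ge> 0" "\<And>x q. \<bar>x (q * N) - x 0 - real (q * N) * \<rho>\<bar>
           \<le> 3 * real q + C * (\<Sum>i<q * N. gap s u (x i) (x (Suc i)))"
    using blocks_displacement[OF weak_kam_subaction[OF u] rot, of N] by blast
  show "\<exists>d>0. \<forall>c'. norm (c' - c) < d \<longrightarrow> norm (\<alpha> c' - \<alpha> c - \<rho> * (c' - c)) \<le> \<eta> * norm (c' - c)"
  proof (intro exI conjI allI impI)
    show "1 / (2 * (C + 1)) > 0" using C(1) by simp
    fix c' assume "norm (c' - c) < 1 / (2 * (C + 1))"
    then have "(C + 1) * \<bar>c' - c\<bar> \<le> 1 / 2" using C(1) by (simp add: field_simps)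
    moreover have "C * \<bar>c' - c\<bar> \<le> (C + 1) * \<bar>c' - c\<bar>" by (intro mult_right_mono) auto
    ultimately have small: "C * \<bar>c' - c\<bar> \<le> 1 / 2" by linarith
    obtain v where v: "twist_kernel.weak_kam (\<lambda>x y. h x y + (c' - c) * (x - y)) (- \<alpha> c') v" using \<alpha> by blast
    define A where "A = \<alpha> c' - \<alpha> c - \<rho> * (c' - c)"
    have A_eq: "s - (- \<alpha> c') - (c' - c) * \<rho> = A" by (simp add: A_def \<alpha>c)
    have A0: "0 \<le> A" using tilted_value_lower[OF u rot v] A_eq by linarith
    have "real N * A \<le> 6 * \<bar>c' - c\<bar>"
      using tilted_value_upper[OF u rot C small v] A_eq by simp
    also have "\<dots> \<le> (real N * \<eta>) * \<bar>c' - c\<bar>"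
      using N \<eta> by (intro mult_right_mono) (auto simp: field_simps)
    finally have "real N * A \<le> real N * (\<eta> * \<bar>c' - c\<bar>)" by (simp add: mult.assoc)
    then have "A \<le> \<eta> * \<bar>c' - c\<bar>" using N0 by (simp add: mult_le_cancel_left)
    then show "norm (\<alpha> c' - \<alpha> c - \<rho> * (c' - c)) \<le> \<eta> * norm (c' - c)"
      using A0 by (simp add: A_def)
  qed
qed

end

section \<open>Generating functions of twist maps\<close>

text \<open>The derivative of S is continuously differentiable, so the partial derivatives are continuous and
  the bound on the mixed derivative integrates to the twist condition.\<close>

lemma generating_function_kernel:
  assumes gf: "generating_function F S"
  shows "\<exists>\<epsilon>. twist_kernel (\<lambda>x y. S (x, y)) (\<lambda>x y. D1 S (x, y)) (\<lambda>x y. D2 S (x, y)) \<epsilon>"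
proof -
  obtain S' where S': "\<And>z. (S has_derivative blinfun_apply (S' z)) (at z)" and C1: "C1 S'"
    using gf unfolding generating_function_def C2_def by blast
  obtain S'' where S'': "\<And>z. (S' has_derivative blinfun_apply (S'' z)) (at z)"
    using C1 unfolding C1_def by blast
  obtain \<epsilon> where \<epsilon>: "\<epsilon> > 0" "\<And>x y. D1 (D2 S) (x, y) < - \<epsilon>"
    using gf unfolding generating_function_def by blast
  have S'_cont: "continuous_on UNIV S'"
    by (intro continuous_at_imp_continuous_on ballI has_derivative_continuous[OF S''])
  have d1: "((\<lambda>s. S (s, y)) has_real_derivative blinfun_apply (S' (x, y)) (1, 0)) (at x)" for x y
  proof -
    have "((\<lambda>s. (s, y)) has_derivative (\<lambda>d. (d, 0))) (at x)"
      by (intro has_derivative_Pair has_derivative_ident has_derivative_const)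
    from has_derivative_compose[OF this S']
    have "((\<lambda>s. S (s, y)) has_derivative (\<lambda>d. blinfun_apply (S' (x, y)) (d, 0))) (at x)" .
    moreover have "(\<lambda>d. blinfun_apply (S' (x, y)) (d, 0)) = (*) (blinfun_apply (S' (x, y)) (1, 0))"
    proof
      show "blinfun_apply (S' (x, y)) (d, 0) = blinfun_apply (S' (x, y)) (1, 0) * d" for d
        using blinfun.scaleR_right[of "S' (x, y)" d "(1, 0)"] by simp
    qed
    ultimately show ?thesis by (simp add: has_field_derivative_def)
  qed
  have d2: "((\<lambda>t. S (x, t)) has_real_derivative blinfun_apply (S' (x, y)) (0, 1)) (at y)" for x y
  proof -
    have "((\<lambda>t. (x, t)) has_derivative (\<lambda>d. (0, d))) (at y)"
      by (intro has_derivative_Pair has_derivative_ident has_derivative_const)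
    from has_derivative_compose[OF this S']
    have "((\<lambda>t. S (x, t)) has_derivative (\<lambda>d. blinfun_apply (S' (x, y)) (0, d))) (at y)" .
    moreover have "(\<lambda>d. blinfun_apply (S' (x, y)) (0, d)) = (*) (blinfun_apply (S' (x, y)) (0, 1))"
    proof
      show "blinfun_apply (S' (x, y)) (0, d) = blinfun_apply (S' (x, y)) (0, 1) * d" for d
        using blinfun.scaleR_right[of "S' (x, y)" d "(0, 1)"] by simp
    qed
    ultimately show ?thesis by (simp add: has_field_derivative_def)
  qed
  have D1: "D1 S (x, y) = blinfun_apply (S' (x, y)) (1, 0)" for x y
    using DERIV_imp_deriv[OF d1] by (simp add: D1_def)
  have D2: "D2 S (x, y) = blinfun_apply (S' (x, y)) (0, 1)" for x y
    using DERIV_imp_deriv[OF d2] by (simp add: D2_def)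
  have d12: "((\<lambda>s. D2 S (s, y)) has_real_derivative D1 (D2 S) (x, y)) (at x)" for x y
  proof -
    have "((\<lambda>s. (s, y)) has_derivative (\<lambda>d. (d, 0))) (at x)"
      by (intro has_derivative_Pair has_derivative_ident has_derivative_const)
    from has_derivative_compose[OF this S'']
    have "((\<lambda>s. S' (s, y)) has_derivative (\<lambda>d. blinfun_apply (S'' (x, y)) (d, 0))) (at x)" .
    from bounded_linear.has_derivative[OF blinfun.bounded_linear_left this]
    have "(\<lambda>s. D2 S (s, y)) differentiable (at x)" unfolding D2 differentiable_def by blast
    then show ?thesis by (simp add: D1_def DERIV_deriv_iff_real_differentiable)
  qed
  have "twist_kernel (\<lambda>x y. S (x, y)) (\<lambda>x y. D1 S (x, y)) (\<lambda>x y. D2 S (x, y)) \<epsilon>"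
  proof
    show "continuous_on UNIV (\<lambda>z. S (fst z, snd z))"
      by (simp only: prod.collapse, intro continuous_at_imp_continuous_on ballI has_derivative_continuous[OF S'])
    show "continuous_on UNIV (\<lambda>z. D1 S (fst z, snd z))" "continuous_on UNIV (\<lambda>z. D2 S (fst z, snd z))"
      unfolding D1 D2 by (auto intro!: continuous_intros S'_cont)
    fix x y x' :: real
    show "((\<lambda>s. S (s, y)) has_real_derivative D1 S (x, y)) (at x)" using d1 D1 by simp
    show "((\<lambda>t. S (x, t)) has_real_derivative D2 S (x, y)) (at y)" using d2 D2 by simp
    show "S (x + 1, y + 1) = S (x, y)" using gf by (simp add: generating_function_def)
    show "D2 S (x', y) \<le> D2 S (x, y) - \<epsilon> * (x' - x)" if "x \<le> x'"
    proof -
      have "D2 S (x', y) + \<epsilon> * x' \<le> D2 S (x, y) + \<epsilon> * x"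
      proof (rule DERIV_nonpos_imp_nonincreasing[OF that], intro exI conjI)
        fix s
        show "((\<lambda>s. D2 S (s, y) + \<epsilon> * s) has_real_derivative D1 (D2 S) (s, y) + \<epsilon>) (at s)"
          by (auto intro!: derivative_eq_intros d12)
        show "D1 (D2 S) (s, y) + \<epsilon> \<le> 0" using \<epsilon>(2)[of s y] by simp
      qed
      then show ?thesis by (simp add: algebra_simps)
    qed
  qed (rule \<epsilon>(1))
  then show ?thesis by blast
qed

lemma Sc_kernel:
  assumes "generating_function F S"
  shows "\<exists>\<epsilon>. twist_kernel (\<lambda>x y. Sc S c (x, y)) (\<lambda>x y. D1 S (x, y) + c) (\<lambda>x y. D2 S (x, y) - c) \<epsilon>"
  using generating_function_kernel[OF assms] twist_kernel.tilted unfolding Sc_def by fastforce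

lemma weak_kam_iff:
  assumes "twist_kernel (\<lambda>x y. Sc S c (x, y)) h1 h2 \<epsilon>"
  shows "twist_kernel.weak_kam (\<lambda>x y. Sc S c (x, y)) s u \<longleftrightarrow>
    continuous_on UNIV u \<and> periodic1 u \<and> (\<forall>x. u x = Tminus S c u x - s)"
  using twist_kernel.weak_kam_def[OF assms] twist_kernel.lax_oleinik_def[OF assms] by (simp add: Tminus_def)

text \<open>Existence and uniqueness of the value make the definite description denote it.\<close>

lemma weak_kam_at_Sbar:
  assumes "generating_function F S"
  shows "\<exists>v. twist_kernel.weak_kam (\<lambda>x y. Sc S c (x, y)) (Sbar S c) v"
proof -
  obtain \<epsilon> where "twist_kernel (\<lambda>x y. Sc S c (x, y)) (\<lambda>x y. D1 S (x, y) + c) (\<lambda>x y. D2 S (x, y) - c) \<epsilon>"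
    using Sc_kernel[OF assms] by blast
  then interpret k: twist_kernel "\<lambda>x y. Sc S c (x, y)" "\<lambda>x y. D1 S (x, y) + c" "\<lambda>x y. D2 S (x, y) - c" \<epsilon> .
  have "\<exists>!s. \<exists>v. k.weak_kam s v" using k.weak_kam_exists k.weak_kam_value_unique by blast
  from theI'[OF this] show ?thesis
    unfolding Sbar_def weak_kam_iff[OF k.twist_kernel_axioms, symmetric] .
qed

theorem theorem1p2:
  fixes f :: "complex \<times> real \<Rightarrow> complex \<times> real"
    and F :: "real \<times> real \<Rightarrow> real \<times> real"
    and S :: "real \<times> real \<Rightarrow> real"
    and c :: real
    and u :: "real \<Rightarrow> real"
  assumes "twist_map f"
    and "is_lift f F"
    and "generating_function F S"
    and "weak_KAM_solution S c u"
  shows "(\<forall>x0\<in>Sing u. \<forall>n. (forward_step S c u ^^ n) x0 \<in> Sing u) \<and>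
         (\<exists>\<rho>. (\<forall>x0\<in>Sing u. (\<lambda>n. ((forward_step S c u ^^ n) x0 - x0) / real n) \<longlonglongrightarrow> \<rho>) \<and>
              has_rotation_number F (Aubry_Mather_set S c) \<rho> \<and>
              (Mather_alpha S has_real_derivative \<rho>) (at c))"
proof -
  note gf = assms(3)
  obtain \<epsilon> where "twist_kernel (\<lambda>x y. Sc S c (x, y)) (\<lambda>x y. D1 S (x, y) + c) (\<lambda>x y. D2 S (x, y) - c) \<epsilon>"
    using Sc_kernel[OF gf] by blast
  then interpret k: twist_kernel "\<lambda>x y. Sc S c (x, y)" "\<lambda>x y. D1 S (x, y) + c" "\<lambda>x y. D2 S (x, y) - c" \<epsilon> .
  define s where "s = Sbar S c"
  have u: "k.weak_kam s u"
    using assms(4) unfolding weak_KAM_solution_def weak_kam_iff[OF k.twist_kernel_axioms] s_def by blast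
  have subaction_iff: "sub_action S c v \<longleftrightarrow> k.subaction s v" for v
    by (simp add: sub_action_def k.subaction_def k.gap_def s_def)
  have Aubry_iff: "x \<in> projected_Aubry S c \<longleftrightarrow> (\<exists>y. k.tight s x y)" for x
  proof -
    have "k.gap s v x y = 0 \<longleftrightarrow> v y - v x = Sc S c (x, y) - Sbar S c" for v y
      unfolding k.gap_def s_def by linarith
    then show ?thesis unfolding projected_Aubry_def k.tight_def by (simp add: subaction_iff)
  qed
  have step: "k.forward_max u x (forward_step S c u x)" for x
  proof -
    obtain B where "\<And>x. \<bar>u x\<bar> \<le> B"
      using k.weak_kam_bounded_periodic[OF u] by (auto simp: bounded_periodic_def)
    then obtain y where y: "\<And>z. u z - Sc S c (x, z) \<le> u y - Sc S c (x, y)"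
      using k.max_attained u unfolding k.weak_kam_def by blast
    show ?thesis unfolding forward_step_def k.forward_max_def
      by (rule arg_maxI[of _ y]) (use y in \<open>auto simp: not_less\<close>)
  qed
  obtain \<rho> where \<rho>: "\<And>x n. k.ordered_chain s x n \<Longrightarrow> \<bar>x n - x 0 - real n * \<rho>\<bar> \<le> 2"
    using k.rotation_number_exists[OF u] by blast
  have part_a: "(forward_step S c u ^^ n) x0 \<in> Sing u" if "x0 \<in> Sing u" for x0 n
    by (induction n) (use that k.forward_max_singular[OF u step] in \<open>auto simp: Sing_def\<close>)
  have part_b: "(\<lambda>n. ((forward_step S c u ^^ n) x0 - x0) / real n) \<longlonglongrightarrow> \<rho>" if "x0 \<in> Sing u" for x0
  proof (rule average_displacement_tendsto)
    fix n
    show "\<bar>(forward_step S c u ^^ n) x0 - x0 - real n * \<rho>\<bar> \<le> 2"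
      using \<rho>[OF k.singular_ordered_chain[OF u, of "\<lambda>n. (forward_step S c u ^^ n) x0" n]] step that
      by (simp add: Sing_def)
  qed
  have F_iff: "F (x, p) = (y, p') \<longleftrightarrow> p = - D1 S (x, y) \<and> p' = D2 S (x, y)" for x p y p'
    using gf by (simp add: generating_function_def)
  \<comment> \<open>Without injectivity, the inverse could leave the tight orbit.\<close>
  have inj: "inj F"
  proof (rule injI)
    fix z w assume eq: "F z = F w"
    obtain y p' where yp: "F w = (y, p')" by fastforce
    have "snd z = - D1 S (fst z, y)" "p' = D2 S (fst z, y)" "snd w = - D1 S (fst w, y)" "p' = D2 S (fst w, y)"
      using F_iff[of "fst z" "snd z" y p'] F_iff[of "fst w" "snd w" y p'] eq yp by simp_all
    then show "z = w" using k.h2_inj[of "fst z" y "fst w"] by (simp add: prod_eq_iff)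
  qed
  \<comment> \<open>On a tight orbit the momentum at a point is given by the step into it and by the step out of it;
    this is why F moves along the orbit.\<close>
  have momentum: "D2 S (x, y) = - D1 S (y, z)" if "k.tight s x y" "k.tight s y z" for x y z
    using k.calibrated_differentiable(2)[OF k.weak_kam_subaction[OF u], of x y z] that k.weak_kam_subaction[OF u]
    by (simp add: k.tight_def)
  have AM: "\<exists>y. k.tight s x y \<and> p = - D1 S (x, y)" if M: "(x, p) \<in> Aubry_Mather_set S c" for x p
  proof -
    have star: "(x, p - c) \<in> Aubry_star S c" using M by (auto simp: Aubry_Mather_set_def)
    then obtain y where y: "k.tight s x y" using Aubry_iff by (auto simp: Aubry_star_def)
    have "(u has_real_derivative p - c) (at x)"
      using star k.weak_kam_subaction[OF u] unfolding Aubry_star_def subaction_iff by auto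
    then have "p - c = - (D1 S (x, y) + c)"
      using k.tight_derivative(1)[OF k.weak_kam_subaction[OF u] y] DERIV_unique by blast
    then show ?thesis using y by auto
  qed
  have "Aubry_Mather_set S c \<noteq> {}"
  proof -
    obtain x y where xy: "k.tight s x y" using k.tight_exists[OF u] by blast
    then have "x \<in> projected_Aubry S c" using Aubry_iff by blast
    moreover have "(v has_real_derivative - (D1 S (x, y) + c)) (at x)" if "sub_action S c v" for v
      using k.tight_derivative(1)[OF _ xy] that by (simp add: subaction_iff)
    ultimately have "(x, - (D1 S (x, y) + c)) \<in> Aubry_star S c" by (simp add: Aubry_star_def)
    then show ?thesis by (auto simp: Aubry_Mather_set_def)
  qed
  moreover have "(\<lambda>n. (fst ((F ^^ n) (x, p)) - x) / real n) \<longlonglongrightarrow> \<rho>"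
    if xp: "(x, p) \<in> Aubry_Mather_set S c" for x p
  proof (rule average_displacement_tendsto)
    fix n
    obtain y where y: "k.tight s x y" "p = - D1 S (x, y)" using AM[OF xp] by blast
    obtain a where a: "a 0 = x" "k.tight_orbit s a" using k.tight_orbit_exists[OF y(1)] by blast
    have t: "k.tight s (a n) (a (Suc n))" for n using a by (simp add: k.tight_orbit_def)
    \<comment> \<open>The momentum p was defined by the step to y, so the orbit has to start with this step.\<close>
    have "a 1 = y"
      using k.gap_zero_from_tight_unique[OF k.weak_kam_subaction[OF u] y(1), of "a 1"] t[of 0] a(1) k.weak_kam_subaction[OF u]
      by (simp add: k.tight_def)
    then have "(F ^^ n) (x, p) = (a n, - D1 S (a n, a (Suc n)))" for n
    proof (induction n)
      case (Suc n)
      then show ?case using F_iff momentum[OF t t] by simp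
    qed (use a y in simp)
    moreover have "k.ordered_chain s a n"
      using t k.weak_kam_subaction[OF u] by (intro k.gap_zero_ordered_chain[OF k.weak_kam_subaction[OF u]]) (simp add: k.tight_def)
    ultimately show "\<bar>fst ((F ^^ n) (x, p)) - x - real n * \<rho>\<bar> \<le> 2" using \<rho> a(1) by fastforce
  qed
  moreover have "(\<lambda>n. (fst ((inv F ^^ n) (x, p)) - x) / (- real n)) \<longlonglongrightarrow> \<rho>"
    if xp: "(x, p) \<in> Aubry_Mather_set S c" for x p
  proof -
    obtain y where y: "k.tight s x y" "p = - D1 S (x, y)" using AM[OF xp] by blast
    obtain b where b: "b 0 = x" "\<And>n. k.tight s (b (Suc n)) (b n)"
      using k.tight_backward_orbit_exists[OF y(1)] by blast
    have orbit: "(inv F ^^ n) (x, p) = (b n, D2 S (b (Suc n), b n))" for n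
    proof (induction n)
      case 0
      show ?case using momentum[OF b(2)[of 0]] y b(1) by simp
    next
      case (Suc n)
      have "F (b (Suc n), D2 S (b (Suc (Suc n)), b (Suc n))) = (b n, D2 S (b (Suc n), b n))"
        using F_iff momentum[OF b(2) b(2)] by simp
      from inv_f_eq[OF inj this] show ?case using Suc by simp
    qed
    have "(\<lambda>n. (x - b n) / real n) \<longlonglongrightarrow> \<rho>"
    proof (rule average_displacement_tendsto)
      fix n
      have "k.tight s (b (n - i)) (b (n - Suc i))" if "i < n" for i
        using b(2)[of "n - Suc i"] that by (simp add: Suc_diff_Suc)
      then have "k.ordered_chain s (\<lambda>i. b (n - i)) n"
        using k.weak_kam_subaction[OF u] by (intro k.gap_zero_ordered_chain[OF k.weak_kam_subaction[OF u]]) (simp add: k.tight_def)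
      from \<rho>[OF this] show "\<bar>x - b n - real n * \<rho>\<bar> \<le> 2" using b(1) by simp
    qed
    moreover have "(fst ((inv F ^^ n) (x, p)) - x) / (- real n) = (x - b n) / real n" for n
      by (simp add: orbit minus_divide_left)
    ultimately show ?thesis by simp
  qed
  ultimately have rotation: "has_rotation_number F (Aubry_Mather_set S c) \<rho>"
    unfolding has_rotation_number_def by blast
  have tilt: "(\<lambda>x y. Sc S c (x, y) + (c' - c) * (x - y)) = (\<lambda>x y. Sc S c' (x, y))" for c'
    by (intro ext) (simp add: Sc_def algebra_simps)
  have "(Mather_alpha S has_real_derivative \<rho>) (at c)"
  proof (rule k.value_has_derivative[OF u \<rho>])
    show "\<exists>v. twist_kernel.weak_kam (\<lambda>x y. Sc S c (x, y) + (c' - c) * (x - y)) (- Mather_alpha S c') v" for c'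
      unfolding tilt using weak_kam_at_Sbar[OF gf] by (simp add: Mather_alpha_def)
    show "Mather_alpha S c = - s" by (simp add: Mather_alpha_def s_def)
  qed
  then show ?thesis using part_a part_b rotation by blast
qed

end
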